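(* Let $0\le c<n$, let $q$ be a unit form in $\mathbf{UQuad}_{\mathbb{A}}^c(n)$, and consider its cycle type $\mathbf{ct}(q)=(\pi_1,\ldots,\pi_\ell)$. Then: (i) The Coxeter number $\mathbf{c}(q)$ of $q$ is finite if and only if $\ell=1$, in which case $\mathbf{c}(q)=\pi_1$. (ii) The reduced Coxeter number $\mathbf{C}_{re}(q)$ of $q$ is $\mathbf{C}_{re}(q)=\mathrm{lcm}(\pi_1,\ldots,\pi_\ell)$, where $\mathrm{lcm}$ denotes least common multiple.
   Context: **Unit forms.** An integral quadratic form $q:\mathbb{Z}^n\to\mathbb{Z}$, $q(x)=\sum_{1\le i\le j\le n}q_{i,j}x_ix_j$ with $q_{i,j}\in\mathbb{Z}$, has upper triangular Gram matrix $\check{G}_q$, the unique upper triangular integer matrix with $q(x)=x^{\mathrm{tr}}\check{G}_qx$, and symmetric Gram matrix $G_q=\check{G}_q+\check{G}_q^{\mathrm{tr}}$. It is a unit form if all diagonal entries of $\check{G}_q$ equal $1$. The form $q$ is non-negative if $q(x)\geq 0$ for all $x$; its corank is $n-\mathrm{rank}(G_q)$; it is connected if the graph on $\{1,\ldots,n\}$ with an edge between $i<j$ whenever $q_{i,j}\neq 0$ is connected. A connected non-negative unit form $q$ of corank $c$ has Dynkin type $\mathbb{A}_r$, where $r=n-c$, if there is a $\mathbb{Z}$-invertible $B$ such that $q(Bx)=\sum_{i=1}^r x_i^2-\sum_{i=1}^{r-1}x_ix_{i+1}$ for all $x\in\mathbb{Z}^n$. For $0\le c<n$, $\mathbf{UQuad}_{\mathbb{A}}^c(n)$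 is the set of connected non-negative unit forms in $n$ variables of corank $c$ and Dynkin type $\mathbb{A}_{n-c}$. **Coxeter numbers.** The Coxeter matrix of $q$ is $\Phi_q=-\check{G}_q^{\mathrm{tr}}\check{G}_q^{-1}$. For a non-negative unit form $q$ there is a minimal $k\ge 1$ such that $\mathrm{Id}-\Phi_q^k$ is nilpotent; this $k$ is the reduced Coxeter number $\mathbf{C}_{re}(q)$. If $\Phi_q^k=\mathrm{Id}$ for some $k\ge1$, the minimal such $k$ is the Coxeter number $\mathbf{c}(q)$; otherwise $\mathbf{c}(q)=\infty$. **Quivers.** A quiver $Q=(Q_0,Q_1,\mathbf{s},\mathbf{t})$ consists of finite totally ordered sets $Q_0$ (vertices) and $Q_1$ (arrows) and functions $\mathbf{s},\mathbf{t}:Q_1\to Q_0$ (source, target). With $|Q_0|=m$, $|Q_1|=n$, its incidence matrix $I(Q)$ is the $m\times n$ matrix whose column for arrow $i$ is $\mathbf{e}_{\mathbf{s}(i)}-\mathbf{e}_{\mathbf{t}(i)}$. The form of $Q$ is $q_Q(x)=\frac12\|I(Q)x\|^2$, $x\in\mathbb{Z}^n$. $Q$ is loop-less if $\mathbf{s}(i)\ne\mathbf{t}(i)$ for all arrows $i$, and connected if its underlying graph is connected. **Permutation of vertices.** Let $Q$ be connected and loop-less with at least one arrow. For a vertex $v$, let $\alpha_Q^-(v)=(v_{-1},i_0,v_0,i_1,v_1,\ldots,i_\ell,v_\ell)$ be the walk with $v_{-1}=v$, $i_0$ the maximal arrow incident to $v$, $v_t$ the end-point of $i_t$ different from $v_{t-1}$,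 $i_{t+1}$ the maximal arrow among the arrows $j<i_t$ incident to $v_t$ (for $t=0,\ldots,\ell-1$), stopping at $v_\ell$ when no arrow $j<i_\ell$ is incident to $v_\ell$. Put $\xi_Q^-(v)=v_\ell$. Then $\xi_Q^-$ is a permutation of $Q_0$. The cycle type $\mathbf{ct}(Q)$ is the sequence of cardinalities of the orbits of $\xi_Q^-$, ordered non-increasingly (a partition of $|Q_0|$). **Cycle type of a form.** It is known that $\mathbf{UQuad}_{\mathbb{A}}^c(n)$ is exactly the set of forms $q_Q$ for $Q$ a connected loop-less quiver with $n$ arrows and $m=n-c+1$ vertices. For $q\in\mathbf{UQuad}_{\mathbb{A}}^c(n)$ put $\mathbf{ct}(q):=\mathbf{ct}(Q)$ for any such $Q$ with $q=q_Q$; this does not depend on the choice of $Q$. *)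

theory Defs
  imports
    "Jordan_Normal_Form.DL_Rank"
    "Graph_Theory.Graph_Theory"
    "HOL-Combinatorics.Orbits"
    "HOL-Library.Extended_Nat"
begin

section \<open>Unit forms\<close>

text \<open>
  A form in \<open>n\<close> variables is a function on integer vectors; only its values on
  \<open>carrier_vec n\<close> are relevant. Indices run over \<open>{0..<n}\<close>.
\<close>

definition is_upper_gram :: "nat \<Rightarrow> (int vec \<Rightarrow> int) \<Rightarrow> int mat \<Rightarrow> bool" where
  "is_upper_gram n q G \<longleftrightarrow>
     G \<in> carrier_mat n n \<and> upper_triangular G \<and>
     (\<forall>x \<in> carrier_vec n. q x = x \<bullet> (G *\<^sub>v x))"

definition integral_form :: "nat \<Rightarrow> (int vec \<Rightarrow> int) \<Rightarrow> bool" where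
  "integral_form n q \<longleftrightarrow> (\<exists>G. is_upper_gram n q G)"

definition upper_gram :: "nat \<Rightarrow> (int vec \<Rightarrow> int) \<Rightarrow> int mat" where
  "upper_gram n q = (THE G. is_upper_gram n q G)"

definition sym_gram :: "nat \<Rightarrow> (int vec \<Rightarrow> int) \<Rightarrow> int mat" where
  "sym_gram n q = upper_gram n q + transpose_mat (upper_gram n q)"

lemma is_upper_gram_diag:
  assumes "is_upper_gram n q G" "i < n"
  shows "G $$ (i, i) = q (unit_vec n i)"
proof -
  have c: "G \<in> carrier_mat n n" using assms by (simp add: is_upper_gram_def)
  have "unit_vec n i \<bullet> (G *\<^sub>v unit_vec n i) = G $$ (i, i)" using c assms(2) by simp
  then show ?thesis using assms by (simp add: is_upper_gram_def)
qed

lemma is_upper_gram_entry: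
  assumes G: "is_upper_gram n q G" and ij: "i < j" "j < n"
  shows "G $$ (i, j) = q (unit_vec n i + unit_vec n j) - q (unit_vec n i) - q (unit_vec n j)"
proof -
  have c: "G \<in> carrier_mat n n" and u: "upper_triangular G"
    using G by (auto simp: is_upper_gram_def)
  have d: "unit_vec n k \<bullet> (G *\<^sub>v unit_vec n l) = G $$ (k, l)" if "k < n" "l < n" for k l
    using c that by simp
  have "q (unit_vec n i + unit_vec n j) =
      (unit_vec n i + unit_vec n j) \<bullet> (G *\<^sub>v (unit_vec n i + unit_vec n j))"
    using G by (simp add: is_upper_gram_def)
  also have "\<dots> = G $$ (i, i) + G $$ (i, j) + (G $$ (j, i) + G $$ (j, j))"
    using c ij d by (simp add: mult_add_distrib_mat_vec[OF c] add_scalar_prod_distrib[of _ n]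
        scalar_prod_add_distrib[of _ n])
  finally show ?thesis
    using upper_triangularD[OF u, of i j] c ij d G by (simp add: is_upper_gram_def)
qed

lemma is_upper_gram_unique:
  assumes G: "is_upper_gram n q G" and H: "is_upper_gram n q H"
  shows "G = H"
proof (rule eq_matI)
  have cG: "G \<in> carrier_mat n n" "upper_triangular G" and cH: "H \<in> carrier_mat n n" "upper_triangular H"
    using G H by (auto simp: is_upper_gram_def)
  fix i j assume "i < dim_row H" "j < dim_col H"
  then have ij: "i < n" "j < n" using cH by auto
  consider "i < j" | "i = j" | "j < i" by linarith
  then show "G $$ (i, j) = H $$ (i, j)"
  proof cases
    case 1
    with is_upper_gram_entry[OF G] is_upper_gram_entry[OF H] ij show ?thesis by simp
  next
    case 2
    with is_upper_gram_diag[OF G] is_upper_gram_diag[OF H] ij show ?thesis by simp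
  next
    case 3
    with cG cH ij show ?thesis by (auto simp: upper_triangular_def)
  qed
qed (use assms in \<open>auto simp: is_upper_gram_def\<close>)

lemma upper_gramI: "is_upper_gram n q G \<Longrightarrow> upper_gram n q = G"
  unfolding upper_gram_def using is_upper_gram_unique by (intro the_equality) blast+

definition unit_form :: "nat \<Rightarrow> (int vec \<Rightarrow> int) \<Rightarrow> bool" where
  "unit_form n q \<longleftrightarrow> integral_form n q \<and> (\<forall>i<n. upper_gram n q $$ (i, i) = 1)"

definition nonneg_form :: "nat \<Rightarrow> (int vec \<Rightarrow> int) \<Rightarrow> bool" where
  "nonneg_form n q \<longleftrightarrow> (\<forall>x \<in> carrier_vec n. q x \<ge> 0)"

definition corank :: "nat \<Rightarrow> (int vec \<Rightarrow> int) \<Rightarrow> nat" where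
  "corank n q = n - vec_space.rank n (map_mat rat_of_int (sym_gram n q))"

definition form_graph :: "nat \<Rightarrow> (int vec \<Rightarrow> int) \<Rightarrow> (nat, nat \<times> nat) pre_digraph" where
  "form_graph n q =
     \<lparr> verts = {..<n}, arcs = {(i, j). i < j \<and> j < n \<and> upper_gram n q $$ (i, j) \<noteq> 0},
       tail = fst, head = snd \<rparr>"

text \<open>\<open>Digraph_Component.connected\<close> refers to the underlying undirected graph.\<close>

definition connected_form :: "nat \<Rightarrow> (int vec \<Rightarrow> int) \<Rightarrow> bool" where
  "connected_form n q \<longleftrightarrow> Digraph_Component.connected (form_graph n q)"

definition dynkin_type_A :: "nat \<Rightarrow> (int vec \<Rightarrow> int) \<Rightarrow> nat \<Rightarrow> bool" where
  "dynkin_type_A n q r \<longleftrightarrow>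
     (\<exists>B \<in> carrier_mat n n. invertible_mat B \<and>
        (\<forall>x \<in> carrier_vec n.
           q (B *\<^sub>v x) = (\<Sum>i<r. (x $ i)\<^sup>2) - (\<Sum>i<r - 1. x $ i * x $ (i + 1))))"

definition UQuad_A :: "nat \<Rightarrow> nat \<Rightarrow> (int vec \<Rightarrow> int) set" where
  "UQuad_A c n =
     {q. unit_form n q \<and> nonneg_form n q \<and> connected_form n q \<and>
         corank n q = c \<and> dynkin_type_A n q (n - c)}"

section \<open>Coxeter numbers\<close>

text \<open>Inverse over the ring of entries; meaningful for \<open>invertible_mat A\<close>.\<close>

definition mat_inv :: "'a::semiring_1 mat \<Rightarrow> 'a mat" where
  "mat_inv A = (THE B. inverts_mat A B \<and> inverts_mat B A)"

definition coxeter_matrix :: "nat \<Rightarrow> (int vec \<Rightarrow> int) \<Rightarrow> int mat" where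
  "coxeter_matrix n q = - (transpose_mat (upper_gram n q) * mat_inv (upper_gram n q))"

definition nilpotent_mat :: "'a::semiring_1 mat \<Rightarrow> bool" where
  "nilpotent_mat A \<longleftrightarrow> (\<exists>k. A ^\<^sub>m k = 0\<^sub>m (dim_row A) (dim_row A))"

definition reduced_coxeter_number :: "nat \<Rightarrow> (int vec \<Rightarrow> int) \<Rightarrow> nat" where
  "reduced_coxeter_number n q =
     (LEAST k. k \<ge> 1 \<and> nilpotent_mat (1\<^sub>m n - coxeter_matrix n q ^\<^sub>m k))"

definition coxeter_number :: "nat \<Rightarrow> (int vec \<Rightarrow> int) \<Rightarrow> enat" where
  "coxeter_number n q =
     (if \<exists>k\<ge>1. coxeter_matrix n q ^\<^sub>m k = 1\<^sub>m n
      then enat (LEAST k. k \<ge> 1 \<and> coxeter_matrix n q ^\<^sub>m k = 1\<^sub>m n)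
      else \<infinity>)"

section \<open>Quivers\<close>

text \<open>
  A quiver is a finite digraph of \<open>Graph_Theory\<close> (multiple arrows and loops allowed) whose
  vertex and arrow types are linearly ordered; \<open>tail\<close> is the source, \<open>head\<close> the target.
  Rows and columns of the incidence matrix follow the orders on vertices and arrows.
\<close>

definition incidence_mat :: "('v::linorder, 'a::linorder) pre_digraph \<Rightarrow> int mat" where
  "incidence_mat Q = mat (card (verts Q)) (card (arcs Q))
     (\<lambda>(i, j). let v = sorted_list_of_set (verts Q) ! i; a = sorted_list_of_set (arcs Q) ! j
              in of_bool (v = tail Q a) - of_bool (v = head Q a))"

definition quiver_form :: "('v::linorder, 'a::linorder) pre_digraph \<Rightarrow> int vec \<Rightarrow> rat" where
  "quiver_form Q x =
     1 / 2 * of_int ((incidence_mat Q *\<^sub>v x) \<bullet> (incidence_mat Q *\<^sub>v x))"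

definition incident :: "('v, 'a) pre_digraph \<Rightarrow> 'v \<Rightarrow> 'a set" where
  "incident Q v = {a \<in> arcs Q. tail Q a = v \<or> head Q a = v}"

definition other_end :: "('v, 'a) pre_digraph \<Rightarrow> 'a \<Rightarrow> 'v \<Rightarrow> 'v" where
  "other_end Q a v = (if tail Q a = v then head Q a else tail Q a)"

text \<open>
  \<open>descend Q i v\<close> lists the pairs \<open>(i\<^sub>t, v\<^sub>t)\<close> of the walk that leaves \<open>v\<close> along the arrow \<open>i\<close>
  and then always continues with the maximal smaller arrow available. The finiteness test
  only serves termination.
\<close>

function descend :: "('v, 'a::linorder) pre_digraph \<Rightarrow> 'a \<Rightarrow> 'v \<Rightarrow> ('a \<times> 'v) list" where
  "descend Q i v =
     (let w = other_end Q i v; J = {j \<in> incident Q w. j < i}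
      in (i, w) # (if finite (arcs Q) \<and> J \<noteq> {} then descend Q (Max J) w else []))"
  by pat_completeness auto
termination
proof (relation "measure (\<lambda>(Q, i, v). card {j \<in> arcs Q. j < i})", goal_cases)
  case (2 Q i v w J)
  then have fin: "finite J" "J \<noteq> {}" by (auto simp: incident_def)
  then have "Max J \<in> J" by simp
  then have "Max J \<in> arcs Q" "Max J < i" using 2 by (auto simp: incident_def)
  then have "{j \<in> arcs Q. j < Max J} \<subset> {j \<in> arcs Q. j < i}" by auto
  with 2 show ?case by (auto intro!: psubset_card_mono)
qed auto

declare descend.simps [simp del]

text \<open>
  The walk starting at \<open>v\<close>, without its initial vertex; meaningful if some arrow is incident
  to \<open>v\<close>, which holds in a connected quiver with an arrow.
\<close>

definition alpha_minus :: "('v, 'a::linorder) pre_digraph \<Rightarrow> 'v \<Rightarrow> ('a \<times> 'v) list" where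
  "alpha_minus Q v = descend Q (Max (incident Q v)) v"

definition xi_minus :: "('v, 'a::linorder) pre_digraph \<Rightarrow> 'v \<Rightarrow> 'v" where
  "xi_minus Q v = snd (last (alpha_minus Q v))"

definition quiver_cycle_type :: "('v, 'a::linorder) pre_digraph \<Rightarrow> nat list" where
  "quiver_cycle_type Q =
     rev (sorted_list_of_multiset (image_mset card (mset_set (orbit (xi_minus Q) ` verts Q))))"

text \<open>
  Every finite totally ordered set is isomorphic to a set of natural numbers, so for the
  cycle type of a form it suffices to consider quivers on \<open>nat\<close>.
\<close>

definition represents :: "(nat, nat) pre_digraph \<Rightarrow> nat \<Rightarrow> (int vec \<Rightarrow> int) \<Rightarrow> bool" where
  "represents Q n q \<longleftrightarrow>
     fin_digraph Q \<and> loopfree_digraph Q \<and> Digraph_Component.connected Q \<and>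
     card (arcs Q) = n \<and> card (verts Q) = n - corank n q + 1 \<and>
     (\<forall>x \<in> carrier_vec n. of_int (q x) = quiver_form Q x)"

text \<open>The cycle type does not depend on the choice of the representing quiver.\<close>

definition cycle_type :: "nat \<Rightarrow> (int vec \<Rightarrow> int) \<Rightarrow> nat list" where
  "cycle_type n q = quiver_cycle_type (SOME Q. represents Q n q)"

end

theory Submission
  imports Defs
begin

text \<open>
  Write \<open>G\<close> for the upper triangular Gram matrix of the form of a quiver with incidence matrix
  \<open>I\<close>, so that \<open>G + G\<^sup>T = I\<^sup>T I\<close>. The Coxeter matrix then equals \<open>\<Phi> = -G\<^sup>T G\<^sup>-\<^sup>1 = 1 - X Y\<close>
  with \<open>X = I\<^sup>T\<close> and \<open>Y = I G\<^sup>-\<^sup>1\<close>. Exchanging the two factors leads from arrows to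
  vertices, where everything is explicit: \<open>P = 1 - Y X = 1 - I G\<^sup>-\<^sup>1 I\<^sup>T\<close> is a product of
  reflections, one for each column of \<open>I\<close>. The reflection at \<open>e\<^sub>s - e\<^sub>t\<close> exchanges the basis
  vectors \<open>e\<^sub>s\<close> and \<open>e\<^sub>t\<close>, so \<open>P\<close> is the matrix of the permutation that applies the
  transpositions of the end-points of all arrows, from the largest arrow to the smallest. The
  walk that defines \<open>\<xi>\<^sup>-\<close> follows one vertex through these transpositions and records only the
  arrows that move it; hence the permutation is \<open>\<xi>\<^sup>-\<close> (\<open>xi_minus_eq_xi\<close>,
  \<open>incidence_inverse_gram\<close>).

  The powers of \<open>\<Phi>\<close> and \<open>P\<close> are linked by \<open>\<Phi>\<^sup>k = 1 - X S Y\<close>, where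
  \<open>S = 1 + P + \<dots> + P\<^sup>k\<^sup>-\<^sup>1\<close> (\<open>one_minus_mult_pow\<close>).

  \<^item> \<open>\<Phi>\<^sup>k = 1\<close> if and only if \<open>I\<^sup>T S I = 0\<close>. The entry of \<open>S\<close> at \<open>(u, w)\<close> counts the visits of the
    first \<open>k\<close> points of the orbit of \<open>w\<close> to \<open>u\<close>. Since the quiver is connected and the rows and
    columns of \<open>S\<close> have the same sums, \<open>I\<^sup>T S I = 0\<close> forces these counts not to depend on \<open>u\<close>.
    This happens exactly if there is a single orbit and its length divides \<open>k\<close>.
  \<^item> \<open>1 - \<Phi>\<^sup>k = X S Y\<close> is nilpotent if and only if \<open>S Y X = S (1 - P) = 1 - P\<^sup>k\<close> is. A permutation
    matrix has finite order, so it is unipotent only if it is the identity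
    (\<open>unipotent_finite_order\<close>), and \<open>P\<^sup>k = 1\<close> means that all orbit lengths divide \<open>k\<close>.

  The cycle type of a form is read off from a quiver representing it, so such a quiver has to
  be produced (\<open>exists_representing_quiver\<close>). The linearly oriented quiver of type A represents
  the standard form; if \<open>M\<close> is its incidence matrix, padded with zero columns, and \<open>B\<close> the
  given change of variables, then \<open>2 q(x) = \<parallel>M B\<^sup>-\<^sup>1 x\<parallel>\<^sup>2\<close>. The columns of \<open>M B\<^sup>-\<^sup>1\<close> are integral, sum
  to zero and have squared length \<open>2\<close>, as \<open>q\<close> is a unit form; so they have the form
  \<open>e\<^sub>s - e\<^sub>t\<close>, and \<open>M B\<^sup>-\<^sup>1\<close> is itself an incidence matrix.
\<close>

section \<open>Powers of \<open>1 - X Y\<close> and of \<open>1 - Y X\<close>\<close>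

primrec geom_mat :: "'a::ring_1 mat \<Rightarrow> nat \<Rightarrow> 'a mat" where
  "geom_mat A 0 = 0\<^sub>m (dim_row A) (dim_row A)"
| "geom_mat A (Suc k) = geom_mat A k + A ^\<^sub>m k"

lemma geom_mat_carrier [simp]: "A \<in> carrier_mat m m \<Longrightarrow> geom_mat A k \<in> carrier_mat m m"
  by (induction k) auto

lemma pow_mat_Suc_left:
  assumes "A \<in> carrier_mat n n"
  shows "A ^\<^sub>m Suc k = A * A ^\<^sub>m k"
proof (induction k)
  case (Suc k)
  then show ?case using assms by (simp add: assoc_mult_mat[of _ n n _ n _ n])
qed (use assms in auto)

lemma geom_mat_telescope:
  fixes A :: "'a::ring_1 mat"
  assumes A: "A \<in> carrier_mat m m"
  shows "geom_mat A k * (1\<^sub>m m - A) = 1\<^sub>m m - A ^\<^sub>m k"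
proof (induction k)
  case 0
  then show ?case using A by auto
next
  case (Suc k)
  have "geom_mat A (Suc k) * (1\<^sub>m m - A) = (1\<^sub>m m - A ^\<^sub>m k) + (A ^\<^sub>m k - A ^\<^sub>m Suc k)"
  proof -
    have "geom_mat A (Suc k) * (1\<^sub>m m - A)
        = geom_mat A k * (1\<^sub>m m - A) + A ^\<^sub>m k * (1\<^sub>m m - A)"
      using A by (simp add: add_mult_distrib_mat[where nr = m and n = m and nc = m] minus_carrier_mat)
    also have "A ^\<^sub>m k * (1\<^sub>m m - A) = A ^\<^sub>m k - A ^\<^sub>m Suc k"
      using A by (subst mult_minus_distrib_mat[of _ m m _ m]) auto
    finally show ?thesis by (simp only: Suc)
  qed
  also have "\<dots> = 1\<^sub>m m - A ^\<^sub>m Suc k"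
    using A by (intro eq_matI) auto
  finally show ?case .
qed

text \<open>
  With \<open>\<Phi> = 1 - X Y\<close> and \<open>P = 1 - Y X\<close> one has \<open>\<Phi> X = X P\<close>, hence
  \<open>\<Phi>\<^sup>k\<^sup>+\<^sup>1 = \<Phi>\<^sup>k - \<Phi>\<^sup>k X Y = \<Phi>\<^sup>k - X P\<^sup>k Y\<close>, and the sum over \<open>k\<close> telescopes.
\<close>
lemma one_minus_mult_pow:
  fixes X Y :: "'a::ring_1 mat"
  assumes X: "X \<in> carrier_mat n m" and Y: "Y \<in> carrier_mat m n"
  defines "P \<equiv> 1\<^sub>m m - Y * X"
  shows "(1\<^sub>m n - X * Y) ^\<^sub>m k = 1\<^sub>m n - X * geom_mat P k * Y"
proof -
  define F where "F = 1\<^sub>m n - X * Y"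
  have P: "P \<in> carrier_mat m m" and F: "F \<in> carrier_mat n n"
    using X Y by (auto simp: P_def F_def)
  have FX: "F * X = X * P"
    using X Y by (simp add: F_def P_def minus_mult_distrib_mat[of _ n n _ _ m]
        mult_minus_distrib_mat[of _ n m _ m] assoc_mult_mat[of _ n m _ n _ m])
  have FkX: "F ^\<^sub>m k * X = X * P ^\<^sub>m k" for k
  proof (induction k)
    case (Suc k)
    have "F ^\<^sub>m Suc k * X = F ^\<^sub>m k * (F * X)"
      using F X by (simp add: assoc_mult_mat[of _ n n _ n _ m])
    also have "\<dots> = (F ^\<^sub>m k * X) * P"
      using F X P by (simp add: FX assoc_mult_mat[of _ n n _ m _ m])
    also have "\<dots> = X * P ^\<^sub>m Suc k"
      using F X P by (simp add: Suc assoc_mult_mat[of _ n m _ m _ m])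
    finally show ?case .
  qed (use F X P in auto)
  show ?thesis unfolding F_def[symmetric]
  proof (induction k)
    case (Suc k)
    have "F ^\<^sub>m Suc k = F ^\<^sub>m k * (1\<^sub>m n - X * Y)" by (simp add: F_def)
    also have "\<dots> = F ^\<^sub>m k - F ^\<^sub>m k * (X * Y)"
      using F X Y by (subst mult_minus_distrib_mat[of _ n n]) auto
    also have "F ^\<^sub>m k * (X * Y) = (F ^\<^sub>m k * X) * Y"
      using F X Y by (simp add: assoc_mult_mat[of _ n n _ m _ n])
    also have "\<dots> = X * P ^\<^sub>m k * Y" by (simp add: FkX)
    also have "F ^\<^sub>m k - \<dots> = 1\<^sub>m n - (X * geom_mat P k * Y + X * P ^\<^sub>m k * Y)"
      unfolding Suc using X Y P by (intro eq_matI) auto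
    also have "X * geom_mat P k * Y + X * P ^\<^sub>m k * Y = X * geom_mat P (Suc k) * Y"
      using X Y P
      by (simp add: add_mult_distrib_mat[where nr = n and n = m and nc = n]
          mult_add_distrib_mat[where nr = n and n = m and nc = m])
    finally show ?case .
  qed (use F X Y P in auto)
qed

lemma mult_pow_Suc:
  fixes X Y :: "'a::ring_1 mat"
  assumes X: "X \<in> carrier_mat n m" and Y: "Y \<in> carrier_mat m n"
  shows "(X * Y) ^\<^sub>m Suc k = X * (Y * X) ^\<^sub>m k * Y"
proof (induction k)
  case (Suc k)
  have c: "(Y * X) ^\<^sub>m k \<in> carrier_mat m m" using X Y by auto
  have "(X * Y) ^\<^sub>m Suc (Suc k) = X * (Y * X) ^\<^sub>m k * Y * (X * Y)"
    using Suc by simp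
  also have "\<dots> = X * ((Y * X) ^\<^sub>m k * (Y * X)) * Y"
    using X Y c mult_carrier_mat[OF c Y] mult_carrier_mat[OF X Y] mult_carrier_mat[OF Y X]
      mult_carrier_mat[OF c mult_carrier_mat[OF Y X]]
    by (simp add: assoc_mult_mat[of _ n m _ n _ n] assoc_mult_mat[of _ n m _ m _ n]
      assoc_mult_mat[of _ m m _ n _ n] assoc_mult_mat[of _ m n _ m _ n] assoc_mult_mat[of _ m m _ m _ n])
  finally show ?case using X Y by simp
qed (use X Y in auto)

lemma nilpotent_mult_commute:
  fixes X Y :: "'a::ring_1 mat"
  assumes X: "X \<in> carrier_mat n m" and Y: "Y \<in> carrier_mat m n"
  shows "nilpotent_mat (X * Y) \<longleftrightarrow> nilpotent_mat (Y * X)"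
proof -
  have *: "nilpotent_mat (B * A)"
    if A: "A \<in> carrier_mat n m" and B: "B \<in> carrier_mat m n" and nil: "nilpotent_mat (A * B)"
    for n m and A B :: "'a mat"
  proof -
    obtain k where "(A * B) ^\<^sub>m k = 0\<^sub>m n n"
      using nil carrier_matD(1)[OF A] unfolding nilpotent_mat_def index_mult_mat(2) by auto
    then have "(B * A) ^\<^sub>m Suc k = 0\<^sub>m m m"
      using A B by (simp add: mult_pow_Suc[OF B A] del: pow_mat.simps)
    then show ?thesis using carrier_matD(1)[OF B]
      unfolding nilpotent_mat_def index_mult_mat(2) by blast
  qed
  show ?thesis using *[OF X Y] *[OF Y X] by blast
qed

text \<open>
  If \<open>N = 1 - A\<close> satisfies \<open>N\<^sup>2 W = 0\<close>, then \<open>Z = N W\<close> is fixed by \<open>A\<close>, so \<open>A\<^sup>i W = W - i Z\<close>. For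
  \<open>i = d\<close> this gives \<open>d Z = 0\<close>, hence \<open>N W = 0\<close>: the kernels of \<open>N\<^sup>2\<close> and \<open>N\<close> agree, and a nilpotent \<open>N\<close>
  with this property vanishes. The entries are integers because \<open>d\<close> must not be a zero divisor.
\<close>
lemma unipotent_finite_order:
  fixes A :: "int mat"
  assumes A: "A \<in> carrier_mat m m" and d: "d \<ge> 1" "A ^\<^sub>m d = 1\<^sub>m m"
    and nil: "nilpotent_mat (1\<^sub>m m - A)"
  shows "A = 1\<^sub>m m"
proof -
  define N where "N = 1\<^sub>m m - A"
  have N: "N \<in> carrier_mat m m" using A by (simp add: N_def minus_carrier_mat)
  \<comment> \<open>The kernels of \<open>N\<^sup>2\<close> and \<open>N\<close> agree, tested on the columns of a matrix \<open>W\<close>.\<close>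
  have kernel: "N * W = 0\<^sub>m m m"
    if W: "W \<in> carrier_mat m m" and NNW: "N * (N * W) = 0\<^sub>m m m" for W
  proof -
    define Z where "Z = N * W"
    have Z: "Z \<in> carrier_mat m m" using N W by (simp add: Z_def)
    have NM: "N * M = M - A * M" if "M \<in> carrier_mat m m" for M
      using that A by (simp add: N_def minus_mult_distrib_mat[of _ m m _ _ m])
    have "Z - A * Z = 0\<^sub>m m m" using NNW NM[OF Z] by (simp add: Z_def)
    then have AZ: "A * Z = Z"
      using A Z by (intro eq_matI) (auto simp: mat_eq_iff)
    have "W - A * W = Z" using NM[OF W] by (simp add: Z_def)
    then have AW: "A * W = W - Z"
      using A W Z by (intro eq_matI) (auto simp: mat_eq_iff algebra_simps)
    have step: "A ^\<^sub>m i * W = W - int i \<cdot>\<^sub>m Z" for i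
    proof (induction i)
      case (Suc i)
      have "A ^\<^sub>m Suc i * W = A * (A ^\<^sub>m i * W)"
        unfolding pow_mat_Suc_left[OF A] using A W by (simp add: assoc_mult_mat[of _ m m _ m _ m])
      also have "\<dots> = A * W - int i \<cdot>\<^sub>m (A * Z)"
        using A W Z
        by (simp add: Suc mult_minus_distrib_mat[of _ m m _ m] mult_smult_distrib[of _ m m _ m])
      also have "\<dots> = W - int (Suc i) \<cdot>\<^sub>m Z"
        using W Z unfolding AZ AW by (intro eq_matI) (auto simp: algebra_simps)
      finally show ?case .
    qed (use W Z A in \<open>auto intro!: eq_matI\<close>)
    have "W = W - int d \<cdot>\<^sub>m Z" using step[of d] W d by simp
    then have "\<And>i j. i < m \<Longrightarrow> j < m \<Longrightarrow> W $$ (i,j) = W $$ (i,j) - int d * Z $$ (i,j)"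
      using W Z by (metis carrier_matD(1) carrier_matD(2) index_minus_mat(1) index_smult_mat(1,2,3))
    then have "Z = 0\<^sub>m m m" using Z d by (intro eq_matI) auto
    then show ?thesis by (simp add: Z_def)
  qed
  obtain k where k: "N ^\<^sub>m k = 0\<^sub>m m m" using nil N by (auto simp: nilpotent_mat_def N_def)
  have "N ^\<^sub>m (Suc k) = 0\<^sub>m m m" using k N by simp
  then have "N ^\<^sub>m (Suc 0) = 0\<^sub>m m m"
  proof (induction k)
    case (Suc k)
    have "N * (N * N ^\<^sub>m k) = 0\<^sub>m m m"
      using Suc.prems N unfolding pow_mat_Suc_left[OF N] by simp
    from kernel[OF _ this] N have "N ^\<^sub>m Suc k = 0\<^sub>m m m"
      unfolding pow_mat_Suc_left[OF N] by simp
    then show ?case by (rule Suc.IH)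
  qed simp
  then have "1\<^sub>m m - A = 0\<^sub>m m m" using N by (simp add: N_def)
  then show ?thesis using A by (intro eq_matI) (auto simp: mat_eq_iff)
qed

text \<open>
  The inverse exists over the integers because the determinant is \<open>1\<close>; it is the adjugate.
\<close>
lemma inverse_upper_unitriangular:
  fixes G :: "int mat"
  assumes G: "G \<in> carrier_mat n n" and ut: "upper_triangular G"
    and diag: "\<And>i. i < n \<Longrightarrow> G $$ (i, i) = 1"
  shows "mat_inv G \<in> carrier_mat n n" "G * mat_inv G = 1\<^sub>m n" "mat_inv G * G = 1\<^sub>m n"
proof -
  define H where "H = adj_mat G"
  have "diag_mat G = replicate n 1"
    using G diag by (intro nth_equalityI) (auto simp: diag_mat_def)
  moreover have smult_one: "1 \<cdot>\<^sub>m 1\<^sub>m n = (1\<^sub>m n :: int mat)" by (intro eq_matI) auto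
  ultimately have "det G = 1" using det_upper_triangular[OF ut G] by simp
  then have H: "H \<in> carrier_mat n n" "G * H = 1\<^sub>m n" "H * G = 1\<^sub>m n"
    using adj_mat[OF G] smult_one by (simp_all add: H_def)
  have "mat_inv G = H" unfolding mat_inv_def
  proof (rule the_equality)
    show "inverts_mat G H \<and> inverts_mat H G" using G H by (simp add: inverts_mat_def)
    fix K assume "inverts_mat G K \<and> inverts_mat K G"
    then have K: "G * K = 1\<^sub>m n" "K * G = 1\<^sub>m (dim_row K)" using G by (auto simp: inverts_mat_def)
    have Kc: "K \<in> carrier_mat n n"
      using arg_cong[OF K(1), of dim_col] arg_cong[OF K(2), of dim_col] G by auto
    have "H * G * K = H * (G * K)" by (rule assoc_mult_mat[OF H(1) G Kc])
    then show "K = H" using H Kc K(1) by simp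
  qed
  with H show "mat_inv G \<in> carrier_mat n n" "G * mat_inv G = 1\<^sub>m n" "mat_inv G * G = 1\<^sub>m n" by auto
qed

section \<open>Orbits, indicator sums and multiples\<close>

lemma card_orbit_dvd_iff:
  assumes "permutation f"
  shows "card (orbit f x) dvd k \<longleftrightarrow> (f ^^ k) x = x"
proof -
  define d where "d = funpow_dist1 f x x"
  have x: "x \<in> orbit f x" using assms by (rule permutation_self_in_orbit)
  have card: "card (orbit f x) = d"
    unfolding orbit_conv_funpow_dist1[OF x] d_def
    by (subst card_image[OF inj_on_funpow_dist1[OF x]]) simp
  have d: "(f ^^ d) x = x" unfolding d_def by (rule funpow_dist1_prop[OF x])
  have m: "(f ^^ (k mod d)) x = (f ^^ k) x" using d by (rule funpow_mod_eq)
  show ?thesis unfolding card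
  proof
    assume "d dvd k"
    then have "k mod d = 0" by simp
    with m show "(f ^^ k) x = x" by (metis funpow_0)
  next
    assume "(f ^^ k) x = x"
    with m have "(f ^^ (k mod d)) x = x" by simp
    moreover have "k mod d < d" unfolding d_def by simp
    ultimately have "\<not> 0 < k mod d"
      using funpow_dist1_least[of "k mod d" f x x] unfolding d_def by blast
    then show "d dvd k" by auto
  qed
qed

lemma sum_mult_of_bool_eq:
  fixes f :: "'a \<Rightarrow> 'b::semiring_1"
  assumes "finite A" "y \<in> A"
  shows "(\<Sum>x\<in>A. f x * of_bool (y = x)) = f y"
proof -
  have "(\<Sum>x\<in>A. f x * of_bool (y = x)) = (\<Sum>x\<in>A. if y = x then f x else 0)"
    by (intro sum.cong) auto
  then show ?thesis using assms by simp
qed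

lemma Least_pos_multiple:
  fixes d :: nat
  assumes "d \<ge> 1" shows "(LEAST k. k \<ge> 1 \<and> d dvd k) = d"
  by (rule Least_equality) (use assms in \<open>auto dest: dvd_imp_le\<close>)

section \<open>The descending walk as a product of transpositions\<close>

locale conn_quiver = fin_digraph Q + loopfree_digraph Q
  for Q :: "('v::linorder, 'a::linorder) pre_digraph" +
  assumes conn: "Digraph_Component.connected Q" and arcs_nonempty: "arcs Q \<noteq> {}"
begin

abbreviation "vs \<equiv> sorted_list_of_set (verts Q)"
abbreviation "as \<equiv> sorted_list_of_set (arcs Q)"
abbreviation "m \<equiv> card (verts Q)"
abbreviation "n \<equiv> card (arcs Q)"

lemma vs_nth_mem [simp]: "i < m \<Longrightarrow> vs ! i \<in> verts Q"
  using nth_mem[of i vs] by simp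

lemma as_nth_mem [simp]: "j < n \<Longrightarrow> as ! j \<in> arcs Q"
  using nth_mem[of j as] by simp

lemma vs_nth_eq_iff: "i < m \<Longrightarrow> j < m \<Longrightarrow> vs ! i = vs ! j \<longleftrightarrow> i = j"
  by (simp add: nth_eq_iff_index_eq)

lemma obtain_vertex_index:
  assumes "x \<in> verts Q" obtains i where "i < m" "x = vs ! i"
  using assms by (metis finite_verts in_set_conv_nth length_sorted_list_of_set set_sorted_list_of_set)

lemma obtain_arrow_index:
  assumes "a \<in> arcs Q" obtains j where "j < n" "a = as ! j"
  using assms by (metis finite_arcs in_set_conv_nth length_sorted_list_of_set set_sorted_list_of_set)

lemma sum_over_vertices: "(\<Sum>i<m. f (vs ! i)) = (\<Sum>x\<in>verts Q. f x)"
proof -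
  have "bij_betw ((!) vs) {..<m} (verts Q)"
    using bij_betw_nth[of vs "{..<m}" "verts Q"] by simp
  then show ?thesis by (rule sum.reindex_bij_betw)
qed

text \<open>
  This is the form in which connectedness enters: everything that an arrow cannot change is
  constant.
\<close>
lemma constant_on_vertices:
  assumes arc: "\<And>a. a \<in> arcs Q \<Longrightarrow> f (tail Q a) = f (head Q a)"
    and uv: "u \<in> verts Q" "v \<in> verts Q"
  shows "f u = f v"
proof -
  have "u \<rightarrow>\<^sup>*\<^bsub>with_proj (mk_symmetric Q)\<^esub> v"
    using conn uv unfolding Digraph_Component.connected_def strongly_connected_def by simp
  then have "(u, v) \<in> (arcs_ends (with_proj (mk_symmetric Q)))\<^sup>*"
    by (rule reachable_rtranclI)
  then show ?thesis
  proof (induction rule: rtrancl_induct)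
    case (step y z)
    then have "(y, z) \<in> parcs (mk_symmetric Q)" by (simp add: arcs_ends_conv)
    then have "f y = f z" using arc by (auto simp: parcs_mk_symmetric)
    with step show ?case by simp
  qed simp
qed

lemma incident_nonempty:
  assumes v: "v \<in> verts Q" shows "incident Q v \<noteq> {}"
proof
  assume "incident Q v = {}"
  then have no: "tail Q a \<noteq> v" "head Q a \<noteq> v" if "a \<in> arcs Q" for a
    using that by (auto simp: incident_def)
  obtain a where a: "a \<in> arcs Q" using arcs_nonempty by blast
  have "(tail Q a = v) = (v = v)"
    by (rule constant_on_vertices[where f = "\<lambda>x. x = v"]) (use no a v in auto)
  with no a show False by simp
qed

text \<open>
  The entry of the incidence matrix at vertex \<open>x\<close> and the \<open>j\<close>-th arrow, that is, the inner
  product of the basis vector of \<open>x\<close> with the \<open>j\<close>-th column. Indexing rows by vertices instead of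
  positions lets permutations of vertices act directly.
\<close>
definition coord :: "'v \<Rightarrow> nat \<Rightarrow> int" where
  "coord x j = of_bool (x = tail Q (as ! j)) - of_bool (x = head Q (as ! j))"

lemma incidence_index:
  "i < m \<Longrightarrow> j < n \<Longrightarrow> incidence_mat Q $$ (i, j) = coord (vs ! i) j"
  by (simp add: incidence_mat_def coord_def Let_def)

lemma incidence_carrier [simp]: "incidence_mat Q \<in> carrier_mat m n"
  by (simp add: incidence_mat_def)

definition swap :: "'a \<Rightarrow> 'v \<Rightarrow> 'v" where
  "swap a = Transposition.transpose (tail Q a) (head Q a)"

text \<open>
  Since \<open>foldr\<close> starts at the end of the sorted list, the largest arrow acts first. On vertices this
  is \<open>xi_minus\<close>, but it fixes everything else, which makes it a permutation of the whole type.
\<close>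
definition xi :: "'v \<Rightarrow> 'v" where
  "xi = foldr swap as"

lemma foldr_swap_permutes: "set l \<subseteq> arcs Q \<Longrightarrow> foldr swap l permutes verts Q"
proof (induction l)
  case Nil
  then show ?case by (simp add: permutes_id[unfolded id_def] id_def)
next
  case (Cons a l)
  then have "swap a permutes verts Q" unfolding swap_def by (intro permutes_swap_id) auto
  with Cons show ?case using permutes_compose[of "foldr swap l" "verts Q" "swap a"] by (simp add: comp_def)
qed

lemma xi_permutes: "xi permutes verts Q"
  unfolding xi_def by (rule foldr_swap_permutes) simp

text \<open>
  The reflection at the column \<open>a = e\<^sub>s - e\<^sub>t\<close> maps \<open>e\<^sub>y\<close> to \<open>e\<^sub>y - (a \<bullet> e\<^sub>y) a\<close>, which is the basis
  vector of the exchanged vertex; here in coordinates.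
\<close>
lemma swap_coord:
  assumes "j < n"
  shows "of_bool (swap (as ! j) y = x) = (of_bool (y = x) - coord y j * coord x j :: int)"
proof -
  have "tail Q (as ! j) \<noteq> head Q (as ! j)" using no_loops assms by simp
  then show ?thesis
    by (auto simp: swap_def coord_def Transposition.transpose_def)
qed

lemma other_end_swap: "a \<in> incident Q v \<Longrightarrow> other_end Q a v = swap a v"
  by (auto simp: incident_def other_end_def swap_def Transposition.transpose_def)

lemma swap_not_incident: "a \<in> arcs Q \<Longrightarrow> a \<notin> incident Q v \<Longrightarrow> swap a v = v"
  by (auto simp: incident_def swap_def Transposition.transpose_def)

text \<open>
  The transpositions of the arrows above the largest incident one do not move the vertex, so they
  can be skipped.
\<close>
lemma foldr_swap_first_incident:
  assumes "sorted_wrt (<) l" "set l \<subseteq> arcs Q"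
  shows "foldr swap l v = (let J = {j \<in> set l. j \<in> incident Q v} in
    if J = {} then v else foldr swap (filter (\<lambda>j. j < Max J) l) (swap (Max J) v))"
  using assms
proof (induction l rule: rev_induct)
  case (snoc x l)
  have less: "j < x" if "j \<in> set l" for j using snoc.prems that by (simp add: sorted_wrt_append)
  show ?case
  proof (cases "x \<in> incident Q v")
    case True
    have "Max {j \<in> set (l @ [x]). j \<in> incident Q v} = x"
      by (intro Max_eqI) (use True less in \<open>auto dest: less_imp_le\<close>)
    moreover have "filter (\<lambda>j. j < x) (l @ [x]) = l" using less by (auto simp: filter_id_conv)
    ultimately show ?thesis using True by (auto simp: Let_def)
  next
    case False
    then have J: "{j \<in> set (l @ [x]). j \<in> incident Q v} = {j \<in> set l. j \<in> incident Q v}" by auto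
    have "swap x v = v" using False snoc.prems by (auto intro: swap_not_incident)
    then have "foldr swap (l @ [x]) v = foldr swap l v" by simp
    moreover have "\<not> x < Max {j \<in> set l. j \<in> incident Q v}"
      if "{j \<in> set l. j \<in> incident Q v} \<noteq> {}"
      using Max_in[OF _ that] less by fastforce
    ultimately show ?thesis using snoc unfolding J by (auto simp: Let_def sorted_wrt_append)
  qed
qed simp

text \<open>
  Along the walk, \<open>foldr_swap_first_incident\<close> passes from one arrow to the next.
\<close>
lemma descend_end:
  assumes "i \<in> incident Q v"
  shows "snd (last (descend Q i v)) = foldr swap (filter (\<lambda>j. j < i) as) (swap i v)"
  using assms
proof (induction i arbitrary: v rule: measure_induct_rule[of "\<lambda>i. card {j \<in> arcs Q. j < i}"])
  case (less i)
  define w where "w = swap i v"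
  define J where "J = {j \<in> incident Q w. j < i}"
  define l where "l = filter (\<lambda>j. j < i) as"
  have w: "other_end Q i v = w" using less.prems by (simp add: w_def other_end_swap)
  have J_alt: "{j \<in> set l. j \<in> incident Q w} = J"
    by (auto simp: l_def J_def incident_def)
  have fin: "finite J" by (simp add: J_alt[symmetric])
  have d: "descend Q i v = (i, w) # (if J \<noteq> {} then descend Q (Max J) w else [])"
    using descend.simps[of Q i v] by (simp only: w J_def Let_def finite_arcs simp_thms)
  have f: "foldr swap l w = (if J = {} then w
      else foldr swap (filter (\<lambda>j. j < Max J) l) (swap (Max J) w))"
    using foldr_swap_first_incident[of l w, unfolded J_alt Let_def]
    by (simp add: sorted_wrt_filter l_def)
  show ?case
  proof (cases "J = {}")
    case True
    with d f show ?thesis by (simp add: w_def l_def)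
  next
    case False
    then have M: "Max J \<in> J" using fin by simp
    have "card {j \<in> arcs Q. j < Max J} < card {j \<in> arcs Q. j < i}"
      by (rule psubset_card_mono) (use M in \<open>auto simp: J_def incident_def\<close>)
    then have IH: "snd (last (descend Q (Max J) w))
        = foldr swap (filter (\<lambda>j. j < Max J) as) (swap (Max J) w)"
      by (rule less.IH) (use M in \<open>simp add: J_def\<close>)
    have "filter (\<lambda>j. j < Max J) l = filter (\<lambda>j. j < Max J) as"
      unfolding l_def filter_filter using M by (auto simp: J_def intro!: filter_cong)
    moreover have "descend Q (Max J) w \<noteq> []" by (subst descend.simps) (simp add: Let_def)
    ultimately show ?thesis using d f IH False by (simp add: w_def l_def)
  qed
qed

lemma xi_minus_eq_xi:
  assumes v: "v \<in> verts Q" shows "xi_minus Q v = xi v"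
proof -
  define J where "J = incident Q v"
  have J: "{j \<in> set as. j \<in> incident Q v} = J" by (auto simp: J_def incident_def)
  have "finite J" by (simp add: J[symmetric])
  moreover have "J \<noteq> {}" using incident_nonempty[OF v] by (simp add: J_def)
  ultimately have "Max J \<in> incident Q v" using Max_in J_def by blast
  then have "xi_minus Q v = foldr swap (filter (\<lambda>j. j < Max J) as) (swap (Max J) v)"
    by (simp add: xi_minus_def alpha_minus_def descend_end J_def)
  also have "\<dots> = xi v"
    unfolding xi_def using \<open>J \<noteq> {}\<close>
    by (subst foldr_swap_first_incident[of as]) (simp_all only: J Let_def if_False, simp_all)
  finally show ?thesis .
qed

text \<open>
  The intermediate stages between the identity, for \<open>j = n\<close>, and \<open>xi\<close>, for \<open>j = 0\<close>.
\<close>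
definition partial :: "nat \<Rightarrow> 'v \<Rightarrow> 'v" where
  "partial j v = foldr swap (drop j as) v"

lemma partial_step: "j < n \<Longrightarrow> partial j v = swap (as ! j) (partial (Suc j) v)"
  by (simp add: partial_def Cons_nth_drop_Suc[symmetric])

lemma partial_0: "partial 0 = xi" and partial_n: "partial n v = v"
  by (simp_all add: partial_def xi_def fun_eq_iff)

lemma partial_verts: "v \<in> verts Q \<Longrightarrow> partial j v \<in> verts Q"
  unfolding partial_def
  using permutes_in_image[OF foldr_swap_permutes[of "drop j as"]] set_drop_subset[of j as] by auto

text \<open>
  Each reflection changes the current basis vector by a multiple of one column, so the total change
  is a combination of columns whose coefficients are read off along the way.
\<close>
lemma partial_telescope:
  assumes "j \<le> n"
  shows "(\<Sum>i\<in>{j..<n}. coord x i * coord (partial (Suc i) v) i)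
    = of_bool (v = x) - of_bool (partial j v = x)"
  using assms
proof (induction rule: inc_induct)
  case base
  then show ?case by (simp add: partial_n)
next
  case (step j)
  then show ?case
    by (simp add: sum.atLeast_Suc_lessThan partial_step swap_coord)
qed

end

section \<open>A permutation matrix inside the Gram matrix\<close>

context conn_quiver begin

definition perm_mat :: "('v \<Rightarrow> 'v) \<Rightarrow> int mat" where
  "perm_mat f = mat m m (\<lambda>(i, j). of_bool (f (vs ! j) = vs ! i))"

lemma perm_mat_carrier [simp]: "perm_mat f \<in> carrier_mat m m"
  by (simp add: perm_mat_def)

text \<open>
  The coefficients \<open>c\<close> of \<open>partial_telescope\<close>, for a starting vertex \<open>v\<close>, satisfy
  \<open>I c = e\<^sub>v - P e\<^sub>v\<close>. They also solve the triangular system \<open>G c = I\<^sup>T e\<^sub>v\<close>: in row \<open>i\<close>, the diagonal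
  term is the inner product of the column \<open>a\<^sub>i\<close> with the vector reached after all arrows above \<open>i\<close>,
  and the remaining terms are the inner product of \<open>a\<^sub>i\<close> with what these arrows have taken away.
  Eliminating \<open>c\<close> gives the claim.
\<close>
lemma incidence_inverse_gram:
  assumes G: "G \<in> carrier_mat n n" and H: "H \<in> carrier_mat n n" and HG: "H * G = 1\<^sub>m n"
    and ut: "upper_triangular G" and diag: "\<And>i. i < n \<Longrightarrow> G $$ (i, i) = 1"
    and off: "\<And>i j. i < j \<Longrightarrow> j < n \<Longrightarrow> G $$ (i, j) = (\<Sum>x\<in>verts Q. coord x i * coord x j)"
  shows "incidence_mat Q * H * (incidence_mat Q)\<^sup>T = 1\<^sub>m m - perm_mat xi"
proof -
  let ?I = "incidence_mat Q"
  \<comment> \<open>Column \<open>u\<close> holds the coefficients for the starting vertex \<open>vs ! u\<close>.\<close>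
  define C where "C = mat n m (\<lambda>(i, u). coord (partial (Suc i) (vs ! u)) i)"
  have C: "C \<in> carrier_mat n m" by (simp add: C_def)
  have I: "?I \<in> carrier_mat m n" "?I\<^sup>T \<in> carrier_mat n m" by auto
  have "G * C = ?I\<^sup>T"
  proof (rule eq_matI)
    fix i u assume "i < dim_row ?I\<^sup>T" "u < dim_col ?I\<^sup>T"
    then have i: "i < n" and u: "u < m" using I by auto
    define v where "v = vs ! u"
    define c where "c j = coord (partial (Suc j) v) j" for j
    have v: "v \<in> verts Q" using u by (simp add: v_def)
    have "(G * C) $$ (i, u) = (\<Sum>j\<in>{0..<n}. G $$ (i, j) * c j)"
      using G C i u by (simp add: scalar_prod_def C_def c_def v_def)
    also have "\<dots> = (\<Sum>j\<in>{i..<n}. G $$ (i, j) * c j)"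
      using ut G i by (intro sum.mono_neutral_right) (auto simp: upper_triangular_def)
    also have "\<dots> = c i + (\<Sum>j\<in>{Suc i..<n}. (\<Sum>x\<in>verts Q. coord x i * coord x j) * c j)"
      using i diag off by (simp add: sum.atLeast_Suc_lessThan)
    also have "(\<Sum>j\<in>{Suc i..<n}. (\<Sum>x\<in>verts Q. coord x i * coord x j) * c j)
        = (\<Sum>x\<in>verts Q. coord x i * (\<Sum>j\<in>{Suc i..<n}. coord x j * c j))"
      by (subst sum_distrib_left, subst sum.swap) (simp add: sum_distrib_right mult.assoc)
    also have "\<dots> = (\<Sum>x\<in>verts Q. coord x i * (of_bool (v = x) - of_bool (partial (Suc i) v = x)))"
      using i unfolding c_def by (subst partial_telescope) auto
    also have "\<dots> = coord v i - c i"
      using i v partial_verts[OF v]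
      by (simp add: right_diff_distrib sum_subtractf sum_mult_of_bool_eq c_def)
    finally show "(G * C) $$ (i, u) = ?I\<^sup>T $$ (i, u)"
      using i u I carrier_matD[OF I(1)] by (simp add: incidence_index v_def)
  qed (use G C carrier_matD[OF I(1)] in auto)
  then have "H * ?I\<^sup>T = (H * G) * C" using G H C by (simp add: assoc_mult_mat[of _ n n _ n _ m])
  then have HI: "H * ?I\<^sup>T = C" using HG C by simp
  have "?I * C = 1\<^sub>m m - perm_mat xi"
  proof (rule eq_matI)
    fix w u assume "w < dim_row (1\<^sub>m m - perm_mat xi)" "u < dim_col (1\<^sub>m m - perm_mat xi)"
    then have w: "w < m" and u: "u < m" by (auto simp: perm_mat_def)
    have "(?I * C) $$ (w, u)
        = (\<Sum>j\<in>{0..<n}. coord (vs ! w) j * coord (partial (Suc j) (vs ! u)) j)"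
      using C w u carrier_matD[OF I(1)] by (simp add: scalar_prod_def C_def incidence_index)
    also have "\<dots> = of_bool (vs ! u = vs ! w) - of_bool (xi (vs ! u) = vs ! w)"
      by (simp add: partial_telescope partial_0)
    finally show "(?I * C) $$ (w, u) = (1\<^sub>m m - perm_mat xi) $$ (w, u)"
      using w u by (auto simp: perm_mat_def vs_nth_eq_iff)
  qed (use C carrier_matD[OF I(1)] in \<open>auto simp: perm_mat_def\<close>)
  then show ?thesis using I H HI by (simp add: assoc_mult_mat[of _ m n _ n _ m])
qed

lemma perm_mat_pow:
  assumes f: "f permutes verts Q"
  shows "perm_mat f ^\<^sub>m k = perm_mat (f ^^ k)"
proof (induction k)
  case 0
  show ?case by (intro eq_matI) (auto simp: perm_mat_def vs_nth_eq_iff)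
next
  case (Suc k)
  have "perm_mat (f ^^ k) * perm_mat f = perm_mat (f ^^ Suc k)"
  proof (rule eq_matI)
    fix i j assume "i < dim_row (perm_mat (f ^^ Suc k))" "j < dim_col (perm_mat (f ^^ Suc k))"
    then have i: "i < m" and j: "j < m" by (auto simp: perm_mat_def)
    have fj: "f (vs ! j) \<in> verts Q" using f j by (simp add: permutes_in_image)
    have "(perm_mat (f ^^ k) * perm_mat f) $$ (i, j)
        = (\<Sum>l<m. of_bool ((f ^^ k) (vs ! l) = vs ! i) * of_bool (f (vs ! j) = vs ! l))"
      using i j by (simp add: perm_mat_def scalar_prod_def lessThan_atLeast0)
    also have "\<dots> = (\<Sum>x\<in>verts Q. of_bool ((f ^^ k) x = vs ! i) * of_bool (f (vs ! j) = x))"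
      by (rule sum_over_vertices)
    also have "\<dots> = of_bool ((f ^^ k) (f (vs ! j)) = vs ! i)"
      using fj by (simp add: sum_mult_of_bool_eq)
    also have "\<dots> = perm_mat (f ^^ Suc k) $$ (i, j)"
      using i j by (simp add: perm_mat_def funpow_swap1)
    finally show "(perm_mat (f ^^ k) * perm_mat f) $$ (i, j) = perm_mat (f ^^ Suc k) $$ (i, j)" .
  qed (auto simp: perm_mat_def)
  then show ?case by (simp only: pow_mat.simps Suc)
qed

lemma perm_mat_eq_one_iff:
  "perm_mat f = 1\<^sub>m m \<longleftrightarrow> (\<forall>x\<in>verts Q. f x = x)" if f: "f permutes verts Q"
proof
  assume eq: "perm_mat f = 1\<^sub>m m"
  show "\<forall>x\<in>verts Q. f x = x"
  proof
    fix x assume "x \<in> verts Q"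
    then obtain j where j: "j < m" "x = vs ! j" by (rule obtain_vertex_index)
    have "perm_mat f $$ (j, j) = 1" using j by (simp add: eq)
    then show "f x = x" using j by (simp add: perm_mat_def)
  qed
next
  assume "\<forall>x\<in>verts Q. f x = x"
  then show "perm_mat f = 1\<^sub>m m"
    by (intro eq_matI) (auto simp: perm_mat_def vs_nth_eq_iff)
qed

end

section \<open>Powers of the Coxeter matrix of a quiver\<close>

context conn_quiver begin

lemma sum_mult_coord:
  assumes "j < n"
  shows "(\<Sum>x\<in>verts Q. f x * coord x j) = f (tail Q (as ! j)) - f (head Q (as ! j))"
proof -
  have "(\<Sum>x\<in>verts Q. f x * coord x j)
      = (\<Sum>x\<in>verts Q. f x * of_bool (tail Q (as ! j) = x) - f x * of_bool (head Q (as ! j) = x))"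
    by (intro sum.cong) (auto simp: coord_def)
  then show ?thesis using assms by (simp add: sum_subtractf sum_mult_of_bool_eq)
qed

lemma permutation_xi: "permutation xi"
  using xi_permutes finite_verts permutation_permutes by blast

lemma xi_funpow_permutes: "(xi ^^ k) permutes verts Q"
  by (induction k) (simp_all only: funpow.simps permutes_id permutes_compose xi_permutes)

lemma orbit_xi_subset: "x \<in> verts Q \<Longrightarrow> orbit xi x \<subseteq> verts Q"
  by (rule permutes_orbit_subset[OF xi_permutes])

lemma verts_nonempty: "verts Q \<noteq> {}"
proof -
  obtain a where "a \<in> arcs Q" using arcs_nonempty by blast
  then have "tail Q a \<in> verts Q" by simp
  then show ?thesis by blast
qed

lemma m_pos: "m > 0"
  using verts_nonempty by (simp add: card_gt_0_iff)

abbreviation "orbits \<equiv> orbit xi ` verts Q"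

lemma orbits_single: "card orbits = 1 \<longleftrightarrow> orbits = {verts Q}"
proof
  assume "card orbits = 1"
  then obtain T where T: "orbits = {T}" by (rule card_1_singletonE)
  obtain x where x: "x \<in> verts Q" using verts_nonempty by blast
  have orb: "orbit xi y = T" if "y \<in> verts Q" for y
    using imageI[OF that, of "orbit xi"] unfolding T by simp
  have "T = verts Q"
  proof
    show "T \<subseteq> verts Q" using orbit_xi_subset[OF x] by (simp only: orb[OF x])
    show "verts Q \<subseteq> T"
      using permutation_self_in_orbit[OF permutation_xi] orb by (metis subsetI)
  qed
  with T show "orbits = {verts Q}" by simp
qed simp

lemma xi_funpow_eq_id_iff:
  "(\<forall>x\<in>verts Q. (xi ^^ k) x = x) \<longleftrightarrow> Lcm (card ` orbits) dvd k"
  by (simp add: Lcm_dvd_iff card_orbit_dvd_iff[OF permutation_xi])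

lemma Lcm_card_orbits_pos: "Lcm (card ` orbits) > 0"
proof -
  have "card (orbit xi x) \<noteq> 0" if "x \<in> verts Q" for x
    using that orbit_xi_subset[OF that] finite_subset[OF _ finite_verts] permutation_self_in_orbit[OF permutation_xi]
    by (metis card_0_eq empty_iff)
  then have "0 \<notin> card ` orbits" by force
  moreover have "Lcm (card ` orbits) = 0 \<longleftrightarrow> 0 \<in> card ` orbits"
    by (rule Lcm_0_iff) simp
  ultimately show ?thesis by (metis neq0_conv)
qed

definition visits :: "nat \<Rightarrow> 'v \<Rightarrow> 'v \<Rightarrow> int" where
  "visits k u w = (\<Sum>j<k. of_bool ((xi ^^ j) w = u))"

lemma sum_visits_source: "u \<in> verts Q \<Longrightarrow> (\<Sum>w\<in>verts Q. visits k u w) = int k"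
proof -
  assume u: "u \<in> verts Q"
  have "(\<Sum>w\<in>verts Q. of_bool ((xi ^^ j) w = u)) = (1 :: int)" for j
  proof -
    have "(\<Sum>w\<in>verts Q. of_bool ((xi ^^ j) w = u)) = (\<Sum>w\<in>verts Q. of_bool (w = u) :: int)"
      using sum.permute[OF xi_funpow_permutes, of "\<lambda>w. of_bool (w = u)" j, symmetric]
      by (simp only: comp_def)
    also have "\<dots> = 1"
      using sum_mult_of_bool_eq[OF finite_verts u, of "\<lambda>_. 1 :: int"] by (simp add: eq_commute)
    finally show ?thesis .
  qed
  then show ?thesis unfolding visits_def by (subst sum.swap) simp
qed

lemma sum_visits_target: "w \<in> verts Q \<Longrightarrow> (\<Sum>u\<in>verts Q. visits k u w) = int k"
proof -
  assume w: "w \<in> verts Q"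
  have "(\<Sum>u\<in>verts Q. of_bool ((xi ^^ j) w = u)) = (1 :: int)" for j
    using sum_mult_of_bool_eq[of "verts Q" "(xi ^^ j) w" "\<lambda>_. 1 :: int"] w
      permutes_in_image[OF xi_funpow_permutes] by simp
  then show ?thesis unfolding visits_def by (subst sum.swap) simp
qed

text \<open>
  Shifting the window of \<open>k\<close> points by one step replaces its first point by \<open>\<xi>\<^sup>k w\<close>, which is the
  same vertex.
\<close>
lemma visits_xi:
  assumes "(xi ^^ k) w = w" shows "visits k (xi u) w = visits k u w"
proof -
  have inj: "xi x = xi y \<longleftrightarrow> x = y" for x y
    using permutes_inj[OF xi_permutes] by (simp add: inj_eq)
  have "visits (Suc k) (xi u) w = of_bool (w = xi u) + visits k u w"
    unfolding visits_def by (subst sum.lessThan_Suc_shift) (simp add: inj)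
  moreover have "visits (Suc k) (xi u) w = visits k (xi u) w + of_bool ((xi ^^ k) w = xi u)"
    by (simp add: visits_def)
  ultimately show ?thesis using assms by simp
qed

text \<open>
  If the \<open>k\<close> visits are distributed evenly over the \<open>m\<close> vertices, each vertex gets \<open>k / m > 0\<close> of
  them, so \<open>m\<close> divides \<open>k\<close> and every vertex is reached. Conversely, if the only orbit has length \<open>m\<close>
  and \<open>m\<close> divides \<open>k\<close>, then \<open>visits_xi\<close> makes the counts constant along the orbit.
\<close>
lemma visits_uniform_iff:
  assumes k: "k \<ge> 1"
  shows "(\<forall>u\<in>verts Q. \<forall>v\<in>verts Q. \<forall>w\<in>verts Q. visits k u w = visits k v w)
    \<longleftrightarrow> card orbits = 1 \<and> m dvd k"
proof
  assume eq: "\<forall>u\<in>verts Q. \<forall>v\<in>verts Q. \<forall>w\<in>verts Q. visits k u w = visits k v w"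
  have mk: "int m * visits k u w = int k" if "u \<in> verts Q" "w \<in> verts Q" for u w
  proof -
    have "(\<Sum>v\<in>verts Q. visits k v w) = (\<Sum>v\<in>verts Q. visits k u w)"
      using eq that by (intro sum.cong refl) blast
    then show ?thesis using sum_visits_target[OF that(2)] by simp
  qed
  obtain x where x: "x \<in> verts Q" using verts_nonempty by blast
  have "int m dvd int k" using mk[OF x x] by (metis dvd_triv_left)
  then have dvd: "m dvd k" by simp
  have "orbit xi w = verts Q" if w: "w \<in> verts Q" for w
  proof
    show "orbit xi w \<subseteq> verts Q" by (rule orbit_xi_subset[OF w])
    show "verts Q \<subseteq> orbit xi w"
    proof
      fix u assume u: "u \<in> verts Q"
      have "\<exists>j. (xi ^^ j) w = u"
      proof (rule ccontr)
        assume "\<not> ?thesis"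
        then have "visits k u w = 0" by (simp add: visits_def)
        then show False using mk[OF u w] k by simp
      qed
      then obtain j where "(xi ^^ j) w = u" ..
      then show "u \<in> orbit xi w"
        unfolding orbit_altdef_permutation[OF permutation_xi] by blast
    qed
  qed
  then have "orbits = {verts Q}" using x by auto
  with dvd show "card orbits = 1 \<and> m dvd k" by simp
next
  assume single: "card orbits = 1 \<and> m dvd k"
  then have "orbits = {verts Q}" using orbits_single by blast
  then have orb: "orbit xi w = verts Q" if "w \<in> verts Q" for w using that by auto
  have to_start: "visits k u w = visits k (xi w) w" if w: "w \<in> verts Q" and u: "u \<in> verts Q" for u w
  proof -
    have "(xi ^^ k) w = w"
      using single orb[OF w] card_orbit_dvd_iff[OF permutation_xi, of w k] by simp
    from visits_xi[OF this] have inv: "visits k (xi v) w = visits k v w" for v .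
    have "u \<in> orbit xi w" using orb[OF w] u by simp
    then show ?thesis by induction (simp_all add: inv)
  qed
  then show "\<forall>u\<in>verts Q. \<forall>v\<in>verts Q. \<forall>w\<in>verts Q. visits k u w = visits k v w"
  proof (intro ballI)
    fix u v w assume "u \<in> verts Q" "v \<in> verts Q" "w \<in> verts Q"
    then show "visits k u w = visits k v w"
      by (simp only: to_start[of w u] to_start[of w v])
  qed
qed

lemma geom_mat_perm_mat:
  "geom_mat (perm_mat xi) k = mat m m (\<lambda>(i, j). visits k (vs ! i) (vs ! j))"
proof (induction k)
  case 0
  show ?case by (intro eq_matI) (auto simp: visits_def perm_mat_def)
next
  case (Suc k)
  then show ?case
    by (simp add: perm_mat_pow[OF xi_permutes])
      (intro eq_matI, auto simp: visits_def perm_mat_def)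
qed

text \<open>
  For a fixed arrow, the difference of the visits to its two ends, as a function of the starting
  vertex, is constant by connectedness. It sums to \<open>k - k = 0\<close> over all starting vertices, so it
  vanishes; connectedness once more makes the visits independent of the target.
\<close>
lemma visits_form_zero_iff:
  "(incidence_mat Q)\<^sup>T * geom_mat (perm_mat xi) k * incidence_mat Q = 0\<^sub>m n n
   \<longleftrightarrow> (\<forall>u\<in>verts Q. \<forall>v\<in>verts Q. \<forall>w\<in>verts Q. visits k u w = visits k v w)"
proof -
  let ?I = "incidence_mat Q" and ?S = "geom_mat (perm_mat xi) k"
  define N where "N = visits k"
  note dims = carrier_matD[OF incidence_carrier]
  have S: "?S = mat m m (\<lambda>(i, j). N (vs ! i) (vs ! j))"
    by (simp add: geom_mat_perm_mat N_def)
  have IS: "(?I\<^sup>T * ?S) $$ (i, w) = N (tail Q (as ! i)) (vs ! w) - N (head Q (as ! i)) (vs ! w)"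
    if i: "i < n" and w: "w < m" for i w
  proof -
    have "(?I\<^sup>T * ?S) $$ (i, w) = (\<Sum>u<m. N (vs ! u) (vs ! w) * coord (vs ! u) i)"
      using i w dims
      by (simp add: S scalar_prod_def incidence_index lessThan_atLeast0 mult.commute)
    also have "\<dots> = (\<Sum>x\<in>verts Q. N x (vs ! w) * coord x i)"
      by (rule sum_over_vertices)
    finally show ?thesis using i by (simp add: sum_mult_coord)
  qed
  \<comment> \<open>The difference of the visits to the two ends of arrow \<open>i\<close>, starting from \<open>w\<close>.\<close>
  define g where "g i w = N (tail Q (as ! i)) w - N (head Q (as ! i)) w" for i w
  have entry: "(?I\<^sup>T * ?S * ?I) $$ (i, j) = g i (tail Q (as ! j)) - g i (head Q (as ! j))"
    if i: "i < n" and j: "j < n" for i j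
  proof -
    have "(?I\<^sup>T * ?S * ?I) $$ (i, j) = (\<Sum>w\<in>{0..<m}. (?I\<^sup>T * ?S) $$ (i, w) * ?I $$ (w, j))"
      using i j dims by (simp add: S scalar_prod_def del: index_mult_mat(1))
        (simp add: S scalar_prod_def)
    also have "\<dots> = (\<Sum>w<m. g i (vs ! w) * coord (vs ! w) j)"
      unfolding lessThan_atLeast0
      using i j by (intro sum.cong) (auto simp: IS g_def incidence_index)
    also have "\<dots> = (\<Sum>x\<in>verts Q. g i x * coord x j)"
      by (rule sum_over_vertices)
    finally show ?thesis using j by (simp add: sum_mult_coord)
  qed
  show ?thesis
  proof
    assume zero: "?I\<^sup>T * ?S * ?I = 0\<^sub>m n n"
    have "N (tail Q a) w = N (head Q a) w" if a: "a \<in> arcs Q" and w: "w \<in> verts Q" for a w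
    proof -
      obtain i where i: "i < n" "a = as ! i" using a by (rule obtain_arrow_index)
      have "g i (tail Q b) = g i (head Q b)" if b: "b \<in> arcs Q" for b
      proof -
        obtain j where j: "j < n" "b = as ! j" using b by (rule obtain_arrow_index)
        then show ?thesis using entry[OF i(1) j(1)] i(1) by (simp add: zero)
      qed
      then have const: "g i x = g i w" if "x \<in> verts Q" for x
        using that w by (rule constant_on_vertices)
      have "int m * g i w = (\<Sum>x\<in>verts Q. g i x)" using const by simp
      also have "\<dots> = 0"
        using i by (simp add: g_def sum_subtractf N_def sum_visits_source)
      finally have "g i w = 0" using verts_nonempty by simp
      then show ?thesis by (simp add: g_def i(2))
    qed
    then show "\<forall>u\<in>verts Q. \<forall>v\<in>verts Q. \<forall>w\<in>verts Q. visits k u w = visits k v w"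
      unfolding N_def[symmetric]
      using constant_on_vertices[where f = "\<lambda>u. N u _"] by meson
  next
    assume uniform: "\<forall>u\<in>verts Q. \<forall>v\<in>verts Q. \<forall>w\<in>verts Q. visits k u w = visits k v w"
    have "g i w = 0" if "i < n" "w \<in> verts Q" for i w
    proof -
      have "tail Q (as ! i) \<in> verts Q" "head Q (as ! i) \<in> verts Q" using that(1) by simp_all
      with uniform that(2) have "visits k (tail Q (as ! i)) w = visits k (head Q (as ! i)) w" by blast
      then show ?thesis by (simp add: g_def N_def)
    qed
    then have "(?I\<^sup>T * ?S * ?I) $$ (i, j) = 0" if "i < n" "j < n" for i j
      using that by (simp add: entry)
    then show "?I\<^sup>T * ?S * ?I = 0\<^sub>m n n"
      using dims by (intro eq_matI) (auto simp del: index_mult_mat(1))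
  qed
qed

text \<open>
  Here \<open>G\<close> is the upper triangular Gram matrix of the form of the quiver and \<open>H\<close> its inverse, so that
  \<open>- (G\<^sup>T * H)\<close> is the Coxeter matrix.
\<close>
context
  fixes G H :: "int mat"
  assumes G: "G \<in> carrier_mat n n" and H: "H \<in> carrier_mat n n"
    and GH: "G * H = 1\<^sub>m n" and HG: "H * G = 1\<^sub>m n"
    and ut: "upper_triangular G" and diag: "\<And>i. i < n \<Longrightarrow> G $$ (i, i) = 1"
    and off: "\<And>i j. i < j \<Longrightarrow> j < n \<Longrightarrow> G $$ (i, j) = (\<Sum>x\<in>verts Q. coord x i * coord x j)"
begin

lemma incidence_gram_perm_mat:
  "incidence_mat Q * H * (incidence_mat Q)\<^sup>T = 1\<^sub>m m - perm_mat xi"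
  by (rule incidence_inverse_gram[OF G H HG ut]) (use diag off in auto)

lemma gram_factor: "G + G\<^sup>T = (incidence_mat Q)\<^sup>T * incidence_mat Q"
proof (rule eq_matI)
  let ?I = "incidence_mat Q"
  note dims = carrier_matD[OF incidence_carrier]
  fix i j assume "i < dim_row (?I\<^sup>T * ?I)" "j < dim_col (?I\<^sup>T * ?I)"
  then have i: "i < n" and j: "j < n" using dims by auto
  have "(?I\<^sup>T * ?I) $$ (i, j) = (\<Sum>u<m. coord (vs ! u) i * coord (vs ! u) j)"
    using i j dims by (simp add: scalar_prod_def incidence_index lessThan_atLeast0)
  also have "\<dots> = (\<Sum>x\<in>verts Q. coord x i * coord x j)" by (rule sum_over_vertices)
  also have "\<dots> = (G + G\<^sup>T) $$ (i, j)"
  proof (cases i j rule: linorder_cases)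
    case less
    then show ?thesis using G i j off[of i j] upper_triangularD[OF ut, of i j] by simp
  next
    case equal
    have "tail Q (as ! i) \<noteq> head Q (as ! i)" using no_loops i by simp
    then have "(\<Sum>x\<in>verts Q. coord x i * coord x i) = 2"
      using i by (subst sum_mult_coord) (auto simp: coord_def)
    then show ?thesis using G i diag[of i] equal by simp
  next
    case greater
    then show ?thesis using G i j off[of j i] upper_triangularD[OF ut, of j i]
      by (simp add: mult.commute)
  qed
  finally show "(G + G\<^sup>T) $$ (i, j) = (?I\<^sup>T * ?I) $$ (i, j)" by simp
qed (use G carrier_matD[OF incidence_carrier] in auto)

text \<open>
  Indeed \<open>I\<^sup>T I H = (G + G\<^sup>T) H = 1 + G\<^sup>T H\<close>, so the Coxeter matrix is \<open>1 - X Y\<close> with \<open>X = I\<^sup>T\<close> and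
  \<open>Y = I H\<close>, while \<open>1 - Y X\<close> is the permutation matrix of \<open>xi\<close>.
\<close>
lemma coxeter_pow:
  "(- (G\<^sup>T * H)) ^\<^sub>m k
    = 1\<^sub>m n - (incidence_mat Q)\<^sup>T * geom_mat (perm_mat xi) k * (incidence_mat Q * H)"
proof -
  let ?I = "incidence_mat Q"
  have I: "?I \<in> carrier_mat m n" "?I\<^sup>T \<in> carrier_mat n m" by auto
  have IH: "?I * H \<in> carrier_mat m n" using I(1) H by (rule mult_carrier_mat)
  have "?I\<^sup>T * (?I * H) = (G + G\<^sup>T) * H"
    using I H by (simp add: gram_factor assoc_mult_mat[of _ n m _ n _ n])
  also have "\<dots> = 1\<^sub>m n + G\<^sup>T * H"
    using G H GH by (simp add: add_mult_distrib_mat[of _ n n _ _ n])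
  finally have "- (G\<^sup>T * H) = 1\<^sub>m n - ?I\<^sup>T * (?I * H)"
    using G H by (intro eq_matI) auto
  moreover have "perm_mat xi = 1\<^sub>m m - ?I * H * ?I\<^sup>T"
    unfolding incidence_gram_perm_mat
    by (intro eq_matI) (auto simp: perm_mat_def)
  ultimately show ?thesis using one_minus_mult_pow[OF I(2) IH, of k] by simp
qed

text \<open>
  Both \<open>1 - \<Phi>\<^sup>k = I\<^sup>T S I H\<close> and \<open>I\<^sup>T S I\<close> vanish together, because \<open>H\<close> is invertible.
\<close>
lemma coxeter_pow_eq_one_iff:
  assumes k: "k \<ge> 1"
  shows "(- (G\<^sup>T * H)) ^\<^sub>m k = 1\<^sub>m n \<longleftrightarrow> card orbits = 1 \<and> m dvd k"
proof -
  let ?I = "incidence_mat Q" and ?S = "geom_mat (perm_mat xi) k"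
  have I: "?I \<in> carrier_mat m n" "?I\<^sup>T \<in> carrier_mat n m" by auto
  have S: "?S \<in> carrier_mat m m" by simp
  define Z where "Z = ?I\<^sup>T * ?S * ?I"
  have Z: "Z \<in> carrier_mat n n"
    unfolding Z_def by (rule mult_carrier_mat[OF mult_carrier_mat[OF I(2) S] I(1)])
  have "?I\<^sup>T * ?S * (?I * H) = Z * H"
    unfolding Z_def by (rule assoc_mult_mat[OF mult_carrier_mat[OF I(2) S] I(1) H, symmetric])
  then have pow: "(- (G\<^sup>T * H)) ^\<^sub>m k = 1\<^sub>m n - Z * H" by (simp add: coxeter_pow)
  have "(- (G\<^sup>T * H)) ^\<^sub>m k = 1\<^sub>m n \<longleftrightarrow> Z * H = 0\<^sub>m n n"
  proof
    assume "(- (G\<^sup>T * H)) ^\<^sub>m k = 1\<^sub>m n"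
    then have eq: "1\<^sub>m n - Z * H = 1\<^sub>m n" by (simp add: pow)
    have ZH: "Z * H \<in> carrier_mat n n" using Z H by auto
    have "(Z * H) $$ (i, j) = 0" if "i < n" "j < n" for i j
      using arg_cong[OF eq, of "\<lambda>M. M $$ (i, j)"] that carrier_matD[OF ZH]
      by (simp del: index_mult_mat)
    then show "Z * H = 0\<^sub>m n n" using ZH by (intro eq_matI) (auto simp del: index_mult_mat(1))
  qed (use pow in \<open>auto intro!: eq_matI\<close>)
  also have "\<dots> \<longleftrightarrow> Z = 0\<^sub>m n n"
  proof
    assume "Z * H = 0\<^sub>m n n"
    then have "Z * H * G = 0\<^sub>m n n" using G by simp
    then show "Z = 0\<^sub>m n n" using Z H G HG by (simp add: assoc_mult_mat[of _ n n _ n _ n])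
  qed (use H in auto)
  also have "\<dots> \<longleftrightarrow> card orbits = 1 \<and> m dvd k"
    unfolding Z_def visits_form_zero_iff visits_uniform_iff[OF k] ..
  finally show ?thesis .
qed

text \<open>
  Nilpotency survives the exchange of \<open>X\<close> and \<open>S Y\<close>, and \<open>S Y X = S (1 - P) = 1 - P\<^sup>k\<close>.
\<close>
lemma coxeter_pow_unipotent_iff:
  "nilpotent_mat (1\<^sub>m n - (- (G\<^sup>T * H)) ^\<^sub>m k) \<longleftrightarrow> Lcm (card ` orbits) dvd k"
proof -
  let ?I = "incidence_mat Q" and ?S = "geom_mat (perm_mat xi) k"
  have I: "?I \<in> carrier_mat m n" "?I\<^sup>T \<in> carrier_mat n m" by auto
  have S: "?S \<in> carrier_mat m m" by simp
  have IH: "?I * H \<in> carrier_mat m n" using I(1) H by (rule mult_carrier_mat)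
  have SIH: "?S * (?I * H) \<in> carrier_mat m n" using S IH by (rule mult_carrier_mat)
  have "1\<^sub>m n - (- (G\<^sup>T * H)) ^\<^sub>m k = ?I\<^sup>T * ?S * (?I * H)"
    unfolding coxeter_pow using mult_carrier_mat[OF mult_carrier_mat[OF I(2) S] IH]
    by (intro eq_matI) (auto simp del: index_mult_mat(1))
  also have "\<dots> = ?I\<^sup>T * (?S * (?I * H))"
    using I S IH by (simp add: assoc_mult_mat[of _ n m _ m _ n])
  finally have "nilpotent_mat (1\<^sub>m n - (- (G\<^sup>T * H)) ^\<^sub>m k)
      \<longleftrightarrow> nilpotent_mat (?S * (?I * H) * ?I\<^sup>T)"
    by (simp only: nilpotent_mult_commute[OF I(2) SIH])
  also have "?S * (?I * H) * ?I\<^sup>T = ?S * (?I * H * ?I\<^sup>T)"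
    using S IH I by (simp add: assoc_mult_mat[of _ m m _ n _ m])
  also have "\<dots> = 1\<^sub>m m - perm_mat (xi ^^ k)"
    unfolding incidence_gram_perm_mat
    by (simp only: geom_mat_telescope[OF perm_mat_carrier] perm_mat_pow[OF xi_permutes])
  also have "nilpotent_mat (1\<^sub>m m - perm_mat (xi ^^ k)) \<longleftrightarrow> perm_mat (xi ^^ k) = 1\<^sub>m m"
  proof
    assume nil: "nilpotent_mat (1\<^sub>m m - perm_mat (xi ^^ k))"
    define d where "d = Lcm (card ` orbits)"
    have "d \<ge> 1" using Lcm_card_orbits_pos by (simp add: d_def)
    have "\<forall>x\<in>verts Q. (xi ^^ (d * k)) x = x"
      unfolding xi_funpow_eq_id_iff by (simp add: d_def)
    then have "perm_mat (xi ^^ (d * k)) = 1\<^sub>m m"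
      by (simp add: perm_mat_eq_one_iff[OF xi_funpow_permutes])
    then have "perm_mat (xi ^^ k) ^\<^sub>m d = 1\<^sub>m m"
      by (simp add: perm_mat_pow[OF xi_funpow_permutes] funpow_mult mult.commute)
    from unipotent_finite_order[OF perm_mat_carrier \<open>d \<ge> 1\<close> this nil]
    show "perm_mat (xi ^^ k) = 1\<^sub>m m" .
  next
    assume "perm_mat (xi ^^ k) = 1\<^sub>m m"
    then show "nilpotent_mat (1\<^sub>m m - perm_mat (xi ^^ k))"
      unfolding nilpotent_mat_def by (intro exI[of _ 1]) auto
  qed
  also have "\<dots> \<longleftrightarrow> Lcm (card ` orbits) dvd k"
    by (simp add: perm_mat_eq_one_iff[OF xi_funpow_permutes] xi_funpow_eq_id_iff)
  finally show ?thesis .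
qed

end

lemma orbit_xi_minus: "x \<in> verts Q \<Longrightarrow> orbit (xi_minus Q) x = orbit xi x"
  by (rule orbit_cong[OF permutation_self_in_orbit[OF permutation_xi]])
    (meson orbit_xi_subset subsetD xi_minus_eq_xi)

lemma mset_quiver_cycle_type:
  "mset (quiver_cycle_type Q) = image_mset card (mset_set orbits)"
proof -
  have "orbit (xi_minus Q) ` verts Q = orbits" using orbit_xi_minus by (auto simp: image_iff)
  then show ?thesis by (simp add: quiver_cycle_type_def)
qed

lemma length_quiver_cycle_type: "length (quiver_cycle_type Q) = card orbits"
  using arg_cong[OF mset_quiver_cycle_type, of size] by simp

lemma set_quiver_cycle_type: "set (quiver_cycle_type Q) = card ` orbits"
  using arg_cong[OF mset_quiver_cycle_type, of set_mset] by simp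

lemma hd_quiver_cycle_type: "card orbits = 1 \<Longrightarrow> hd (quiver_cycle_type Q) = m"
proof -
  assume 1: "card orbits = 1"
  then have "length (quiver_cycle_type Q) = 1" by (simp add: length_quiver_cycle_type)
  then have "hd (quiver_cycle_type Q) \<in> set (quiver_cycle_type Q)" by (intro hd_in_set) auto
  moreover have "set (quiver_cycle_type Q) = {m}"
    using 1 unfolding set_quiver_cycle_type orbits_single by simp
  ultimately show ?thesis by simp
qed

end

section \<open>Forms of Dynkin type A come from quivers\<close>

text \<open>
  A zero sum requires a positive and a negative entry; their squares already exhaust the \<open>2\<close>.
\<close>
lemma sum_two_unit_entries:
  fixes f :: "nat \<Rightarrow> int"
  assumes sq: "(\<Sum>i<m. (f i)\<^sup>2) = 2" and sm: "(\<Sum>i<m. f i) = 0"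
  obtains s t where "s < m" "t < m" "s \<noteq> t" "\<And>i. i < m \<Longrightarrow> f i = of_bool (i = s) - of_bool (i = t)"
proof -
  have "\<exists>i<m. f i \<noteq> 0" using sq by (metis (mono_tags, lifting) lessThan_iff power_zero_numeral sum.neutral zero_neq_numeral)
  have "\<exists>s<m. f s > 0"
  proof (rule ccontr)
    assume "\<not> ?thesis"
    then have "\<forall>i\<in>{..<m}. - f i \<ge> 0" by force
    then have "\<forall>i\<in>{..<m}. - f i = 0"
      using sum_nonneg_eq_0_iff[of "{..<m}" "\<lambda>i. - f i"] sm by (simp add: sum_negf)
    then show False using \<open>\<exists>i<m. f i \<noteq> 0\<close> by auto
  qed
  then obtain s where s: "s < m" "f s > 0" by blast
  have "\<exists>t<m. f t < 0"
  proof (rule ccontr)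
    assume "\<not> ?thesis"
    then have "\<forall>i\<in>{..<m}. f i \<ge> 0" by force
    then have "\<forall>i\<in>{..<m}. f i = 0"
      using sum_nonneg_eq_0_iff[of "{..<m}" f] sm by simp
    then show False using \<open>\<exists>i<m. f i \<noteq> 0\<close> by auto
  qed
  then obtain t where t: "t < m" "f t < 0" by blast
  have st: "s \<noteq> t" using s t by auto
  have sq1: "(f s)\<^sup>2 \<ge> f s" "(f t)\<^sup>2 \<ge> - f t"
    using s t mult_right_mono[of 1 "f s" "f s"] mult_right_mono[of 1 "- f t" "- f t"]
    by (auto simp: power2_eq_square)
  have "2 = (f s)\<^sup>2 + (\<Sum>i\<in>{..<m} - {s}. (f i)\<^sup>2)"
    using s sq by (simp add: sum.remove[of "{..<m}" s])
  also have "(\<Sum>i\<in>{..<m} - {s}. (f i)\<^sup>2) = (f t)\<^sup>2 + (\<Sum>i\<in>{..<m} - {s} - {t}. (f i)\<^sup>2)"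
    using t st by (intro sum.remove) auto
  finally have eq: "(f s)\<^sup>2 + ((f t)\<^sup>2 + (\<Sum>i\<in>{..<m} - {s} - {t}. (f i)\<^sup>2)) = 2" by simp
  moreover have "(\<Sum>i\<in>{..<m} - {s} - {t}. (f i)\<^sup>2) \<ge> 0" by (intro sum_nonneg) auto
  ultimately have "f s = 1" "f t = -1" and z: "(\<Sum>i\<in>{..<m} - {s} - {t}. (f i)\<^sup>2) = 0"
    using sq1 s t by auto
  moreover have "f i = 0" if "i < m" "i \<noteq> s" "i \<noteq> t" for i
    using z that by (subst (asm) sum_nonneg_eq_0_iff) auto
  ultimately show ?thesis using that[of s t] s t st by force
qed

text \<open>
  The property of being reachable from \<open>u\<close> is itself unchanged along arrows.
\<close>
lemma connected_if_invariants_constant: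
  assumes wf: "wf_digraph Q" and ne: "verts Q \<noteq> {}"
    and const: "\<And>\<phi> u v. (\<And>a. a \<in> arcs Q \<Longrightarrow> \<phi> (tail Q a) \<longleftrightarrow> \<phi> (head Q a)) \<Longrightarrow>
      u \<in> verts Q \<Longrightarrow> v \<in> verts Q \<Longrightarrow> \<phi> u \<Longrightarrow> \<phi> v"
  shows "Digraph_Component.connected Q"
proof -
  interpret wf_digraph Q by fact
  define E where "E = parcs (mk_symmetric Q)"
  have E: "(tail Q a, head Q a) \<in> E" "(head Q a, tail Q a) \<in> E" if "a \<in> arcs Q" for a
    using that by (auto simp: E_def parcs_mk_symmetric)
  have "(u, v) \<in> rtrancl_on (verts Q) E" if u: "u \<in> verts Q" and v: "v \<in> verts Q" for u v
  proof (rule const[where \<phi> = "\<lambda>w. (u, w) \<in> rtrancl_on (verts Q) E", OF _ u v])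
    fix a assume a: "a \<in> arcs Q"
    show "(u, tail Q a) \<in> rtrancl_on (verts Q) E \<longleftrightarrow> (u, head Q a) \<in> rtrancl_on (verts Q) E"
      using rtrancl_on_into_rtrancl_on[OF _ E(1)[OF a]] rtrancl_on_into_rtrancl_on[OF _ E(2)[OF a]]
        head_in_verts[OF a] tail_in_verts[OF a] by blast
  qed (use u in simp)
  then show ?thesis
    using ne by (auto simp: Digraph_Component.connected_def strongly_connected_def reachable_def E_def)
qed

text \<open>
  The incidence matrix of \<open>0 \<rightarrow> 1 \<rightarrow> \<dots> \<rightarrow> r\<close>, padded with \<open>n - r\<close> zero columns: the standard form of
  type A does not depend on the last variables.
\<close>
definition linear_incidence :: "nat \<Rightarrow> nat \<Rightarrow> int mat" where
  "linear_incidence r n = mat (Suc r) n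
     (\<lambda>(i, j). if j < r then of_bool (j = i) - of_bool (Suc j = i) else 0)"

lemma linear_incidence_carrier [simp]: "linear_incidence r n \<in> carrier_mat (Suc r) n"
  by (simp add: linear_incidence_def)

lemma linear_incidence_mult_vec:
  assumes "r \<le> n" "y \<in> carrier_vec n" "i \<le> r"
  shows "(linear_incidence r n *\<^sub>v y) $ i
    = (if i < r then y $ i else 0) - (case i of 0 \<Rightarrow> 0 | Suc l \<Rightarrow> y $ l)"
proof -
  have "(linear_incidence r n *\<^sub>v y) $ i
      = (\<Sum>j\<in>{0..<n}. linear_incidence r n $$ (i, j) * y $ j)"
    using assms by (simp add: scalar_prod_def linear_incidence_def)
  also have "\<dots> = (\<Sum>j\<in>{..<r}. linear_incidence r n $$ (i, j) * y $ j)"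
    using assms by (intro sum.mono_neutral_right) (auto simp: linear_incidence_def)
  also have "\<dots> = (\<Sum>j<r. (if j = i then y $ j else 0) - (if Suc j = i then y $ j else 0))"
    using assms by (intro sum.cong) (auto simp: linear_incidence_def)
  also have "\<dots> = (\<Sum>j<r. if j = i then y $ j else 0) - (\<Sum>j<r. if Suc j = i then y $ j else 0)"
    by (rule sum_subtractf)
  also have "(\<Sum>j<r. if j = i then y $ j else 0) = (if i < r then y $ i else 0)"
    by simp
  also have "(\<Sum>j<r. if Suc j = i then y $ j else 0) = (case i of 0 \<Rightarrow> 0 | Suc l \<Rightarrow> y $ l)"
    using assms by (cases i) simp_all
  finally show ?thesis .
qed

text \<open>
  Every vertex of the path contributes the square of a difference of neighbours (with \<open>0\<close> beyond the
  ends), so each square gets the coefficient \<open>2\<close> and each product of neighbours the coefficient \<open>-2\<close>.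
\<close>
lemma linear_form_sum_squares:
  fixes y :: "nat \<Rightarrow> int"
  assumes "r \<ge> 1"
  shows "(\<Sum>i<Suc r. ((if i < r then y i else 0) - (case i of 0 \<Rightarrow> 0 | Suc l \<Rightarrow> y l))\<^sup>2)
    = 2 * ((\<Sum>i<r. (y i)\<^sup>2) - (\<Sum>i<r - 1. y i * y (i + 1)))"
proof -
  obtain k where r: "r = Suc k" using assms by (cases r) auto
  have "(\<Sum>i<Suc r. ((if i < r then y i else 0) - (case i of 0 \<Rightarrow> 0 | Suc l \<Rightarrow> y l))\<^sup>2)
      = (\<Sum>i<r. (y i - (case i of 0 \<Rightarrow> 0 | Suc l \<Rightarrow> y l))\<^sup>2) + (y k)\<^sup>2"
    by (simp add: r)
  also have "(\<Sum>i<r. (y i - (case i of 0 \<Rightarrow> 0 | Suc l \<Rightarrow> y l))\<^sup>2)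
      = (y 0)\<^sup>2 + (\<Sum>i<k. (y (Suc i) - y i)\<^sup>2)"
    unfolding r by (subst sum.lessThan_Suc_shift) simp
  also have "(\<Sum>i<k. (y (Suc i) - y i)\<^sup>2)
      = (\<Sum>i<k. (y (Suc i))\<^sup>2) + (\<Sum>i<k. (y i)\<^sup>2) - 2 * (\<Sum>i<k. y i * y (i + 1))"
    by (simp add: power2_diff sum.distrib sum_subtractf sum_distrib_left mult_ac)
  finally have "(\<Sum>i<Suc r. ((if i < r then y i else 0) - (case i of 0 \<Rightarrow> 0 | Suc l \<Rightarrow> y l))\<^sup>2)
      = ((y 0)\<^sup>2 + (\<Sum>i<k. (y (Suc i))\<^sup>2)) + ((\<Sum>i<k. (y i)\<^sup>2) + (y k)\<^sup>2)
        - 2 * (\<Sum>i<k. y i * y (i + 1))" by linarith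
  also have "(y 0)\<^sup>2 + (\<Sum>i<k. (y (Suc i))\<^sup>2) = (\<Sum>i<r. (y i)\<^sup>2)"
    unfolding r by (subst sum.lessThan_Suc_shift) simp
  also have "(\<Sum>i<k. (y i)\<^sup>2) + (y k)\<^sup>2 = (\<Sum>i<r. (y i)\<^sup>2)" by (simp add: r)
  finally show ?thesis by (simp add: r)
qed

text \<open>
  Connectedness of the quiver comes from the change of variables: a function on the vertices that no
  arrow changes annihilates the columns of \<open>M B\<^sup>-\<^sup>1\<close>, hence those of \<open>M\<close>, and the linear quiver is
  connected.
\<close>
lemma exists_representing_quiver:
  assumes cn: "c < n" and q: "q \<in> UQuad_A c n"
  shows "\<exists>Q. represents Q n q"
proof -
  define r where "r = n - c"
  have r: "r \<ge> 1" "r \<le> n" using cn by (auto simp: r_def)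
  have unit: "unit_form n q" and corank: "corank n q = c" and dyn: "dynkin_type_A n q r"
    using q by (auto simp: UQuad_A_def r_def)
  obtain B where B: "B \<in> carrier_mat n n" "invertible_mat B"
    and qB: "\<And>x. x \<in> carrier_vec n \<Longrightarrow>
      q (B *\<^sub>v x) = (\<Sum>i<r. (x $ i)\<^sup>2) - (\<Sum>i<r - 1. x $ i * x $ (i + 1))"
    using dyn by (auto simp: dynkin_type_A_def)
  obtain D where "inverts_mat B D" "inverts_mat D B"
    using B(2) by (auto simp: invertible_mat_def)
  then have BD: "B * D = 1\<^sub>m n" and DB: "D * B = 1\<^sub>m (dim_row D)"
    using B(1) by (auto simp: inverts_mat_def)
  have D: "D \<in> carrier_mat n n"
    using arg_cong[OF BD, of dim_col] arg_cong[OF DB, of dim_col] B(1) by auto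
  then have DB: "D * B = 1\<^sub>m n" using DB by simp
  define M where "M = linear_incidence r n"
  \<comment> \<open>This will be the incidence matrix of the quiver.\<close>
  define C where "C = M * D"
  have M: "M \<in> carrier_mat (Suc r) n" by (simp add: M_def)
  have C: "C \<in> carrier_mat (Suc r) n" using M D by (auto simp: C_def)
  have norm: "(C *\<^sub>v x) \<bullet> (C *\<^sub>v x) = 2 * q x" if x: "x \<in> carrier_vec n" for x
  proof -
    define y where "y = D *\<^sub>v x"
    have y: "y \<in> carrier_vec n" using D x by (simp add: y_def)
    have Cx: "C *\<^sub>v x = M *\<^sub>v y"
      unfolding C_def y_def by (rule assoc_mult_mat_vec[OF M D x])
    have "B *\<^sub>v y = B * D *\<^sub>v x" unfolding y_def by (rule assoc_mult_mat_vec[OF B(1) D x, symmetric])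
    then have By: "B *\<^sub>v y = x" using x by (simp add: BD)
    have "(M *\<^sub>v y) \<bullet> (M *\<^sub>v y) = (\<Sum>i<Suc r. ((M *\<^sub>v y) $ i)\<^sup>2)"
      using M by (simp add: scalar_prod_def power2_eq_square lessThan_atLeast0)
    also have "\<dots> = (\<Sum>i<Suc r. ((if i < r then y $ i else 0) - (case i of 0 \<Rightarrow> 0 | Suc l \<Rightarrow> y $ l))\<^sup>2)"
      by (intro sum.cong refl) (simp add: M_def linear_incidence_mult_vec[OF r(2) y])
    also have "\<dots> = 2 * q (B *\<^sub>v y)"
      by (simp only: linear_form_sum_squares[OF r(1)] qB[OF y])
    finally show ?thesis by (simp add: Cx By)
  qed
  have M_col: "(\<Sum>i<Suc r. M $$ (i, j)) = 0" if "j < n" for j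
  proof (cases "j < r")
    case True
    then have "(\<Sum>i<Suc r. M $$ (i, j))
        = (\<Sum>i<Suc r. if j = i then 1 else 0) - (\<Sum>i<Suc r. if Suc j = i then 1 else 0)"
      using that unfolding sum_subtractf[symmetric]
      by (intro sum.cong) (auto simp: M_def linear_incidence_def)
    also have "\<dots> = 0" using True by (simp del: sum.lessThan_Suc)
    finally show ?thesis .
  qed (use that in \<open>simp add: M_def linear_incidence_def\<close>)
  have mult_left: "(\<Sum>i<Suc r. f i * (X * Y) $$ (i, j)) = (\<Sum>l<n. (\<Sum>i<Suc r. f i * X $$ (i, l)) * Y $$ (l, j))"
    if "X \<in> carrier_mat (Suc r) n" "Y \<in> carrier_mat n n" "j < n" for f and X Y :: "int mat" and j
  proof -
    have "(\<Sum>i<Suc r. f i * (X * Y) $$ (i, j)) = (\<Sum>i<Suc r. \<Sum>l<n. f i * X $$ (i, l) * Y $$ (l, j))"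
      using that by (intro sum.cong refl)
        (simp add: scalar_prod_def lessThan_atLeast0 sum_distrib_left mult.assoc)
    also have "\<dots> = (\<Sum>l<n. (\<Sum>i<Suc r. f i * X $$ (i, l)) * Y $$ (l, j))"
      by (subst sum.swap) (simp only: sum_distrib_right)
    finally show ?thesis .
  qed
  have "\<exists>s t. s < Suc r \<and> t < Suc r \<and> s \<noteq> t \<and>
      (\<forall>i<Suc r. C $$ (i, j) = of_bool (i = s) - of_bool (i = t))" if j: "j < n" for j
  proof -
    have Cj: "C *\<^sub>v unit_vec n j = col C j"
      using C j by (intro eq_vecI) auto
    obtain G where G: "is_upper_gram n q G"
      using unit by (auto simp: unit_form_def integral_form_def)
    have "q (unit_vec n j) = 1"
      using is_upper_gram_diag[OF G j] unit j upper_gramI[OF G] by (simp add: unit_form_def)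
    then have "(\<Sum>i<Suc r. (C $$ (i, j))\<^sup>2) = 2"
      using norm[of "unit_vec n j"] C j unfolding Cj
      by (simp add: scalar_prod_def power2_eq_square lessThan_atLeast0)
    moreover have "(\<Sum>i<Suc r. C $$ (i, j)) = 0"
      using mult_left[OF M D j, of "\<lambda>_. 1"] M_col unfolding C_def by simp
    ultimately show ?thesis using sum_two_unit_entries[of "\<lambda>i. C $$ (i, j)" "Suc r"] by metis
  qed
  then obtain s t where st: "\<And>j. j < n \<Longrightarrow> s j < Suc r" "\<And>j. j < n \<Longrightarrow> t j < Suc r"
      "\<And>j. j < n \<Longrightarrow> s j \<noteq> t j"
    and C_entry: "\<And>i j. i < Suc r \<Longrightarrow> j < n \<Longrightarrow> C $$ (i, j) = of_bool (i = s j) - of_bool (i = t j)"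
    by metis
  define Q :: "(nat, nat) pre_digraph" where
    "Q = \<lparr> verts = {..<Suc r}, arcs = {..<n}, tail = s, head = t \<rparr>"
  have sel: "verts Q = {..<Suc r}" "arcs Q = {..<n}" "tail Q = s" "head Q = t"
    by (simp_all add: Q_def)
  have fin: "fin_digraph Q" and loop: "loopfree_digraph Q"
    using st by (unfold_locales; simp add: sel)+
  have sorted: "sorted_list_of_set {..<k} = [0..<k]" for k :: nat
    by (simp add: lessThan_atLeast0)
  have "incidence_mat Q = C"
    using C by (intro eq_matI)
      (auto simp: incidence_mat_def sel sorted C_entry Let_def simp del: upt_Suc)
  then have form: "of_int (q x) = quiver_form Q x" if "x \<in> carrier_vec n" for x
    using norm[OF that] by (simp add: quiver_form_def)
  have "Digraph_Component.connected Q"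
  proof (rule connected_if_invariants_constant)
    show "wf_digraph Q" using fin by (rule fin_digraph.axioms)
    show "verts Q \<noteq> {}" by (auto simp: sel)
    fix \<phi> u v
    assume inv: "\<And>a. a \<in> arcs Q \<Longrightarrow> \<phi> (tail Q a) \<longleftrightarrow> \<phi> (head Q a)"
      and u: "u \<in> verts Q" and v: "v \<in> verts Q" and "\<phi> u"
    \<comment> \<open>As a row vector, \<open>f\<close> annihilates \<open>C\<close>, hence also \<open>M = C B\<close>; so it is constant along the
      linear quiver.\<close>
    define f :: "nat \<Rightarrow> int" where "f i = of_bool (\<phi> i)" for i
    have fst: "f (s j) = f (t j)" if "j < n" for j
      using inv[of j] that by (simp add: f_def sel)
    have fC: "(\<Sum>i<Suc r. f i * C $$ (i, j)) = 0" if j: "j < n" for j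
    proof -
      have "(\<Sum>i<Suc r. f i * C $$ (i, j))
          = (\<Sum>i<Suc r. f i * of_bool (s j = i)) - (\<Sum>i<Suc r. f i * of_bool (t j = i))"
        unfolding sum_subtractf[symmetric]
        by (intro sum.cong refl) (auto simp: C_entry j right_diff_distrib)
      also have "\<dots> = f (s j) - f (t j)"
        using st(1,2)[OF j] by (simp add: sum_mult_of_bool_eq del: sum.lessThan_Suc)
      finally show ?thesis by (simp add: fst j)
    qed
    have CB: "C * B = M"
      unfolding C_def using assoc_mult_mat[OF M D B(1)] M by (simp add: DB)
    have step: "f (Suc l) = f l" if l: "l < r" for l
    proof -
      have "(\<Sum>i<Suc r. f i * M $$ (i, l)) = 0"
        using mult_left[OF C B(1), of l f] l r fC unfolding CB by simp
      moreover have "(\<Sum>i<Suc r. f i * M $$ (i, l))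
          = (\<Sum>i<Suc r. f i * of_bool (l = i)) - (\<Sum>i<Suc r. f i * of_bool (Suc l = i))"
        unfolding sum_subtractf[symmetric] using l r
        by (intro sum.cong refl) (auto simp: M_def linear_incidence_def right_diff_distrib)
      moreover have "\<dots> = f l - f (Suc l)"
        using l by (simp add: sum_mult_of_bool_eq del: sum.lessThan_Suc)
      ultimately show ?thesis by simp
    qed
    have to_0: "f l = f 0" if "l \<le> r" for l
      using that by (induction l) (simp_all add: step)
    have "u \<le> r" "v \<le> r" using u v by (simp_all add: sel)
    then have "f u = f v" by (simp only: to_0[of u] to_0[of v])
    with \<open>\<phi> u\<close> show "\<phi> v" by (simp add: f_def split: if_splits)
  qed
  then have "represents Q n q"
    using fin loop form corank by (simp add: represents_def sel r_def)
  then show ?thesis ..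
qed

section \<open>Coxeter numbers and cycle type\<close>

text \<open>
  By polarisation the off-diagonal entries of the Gram matrix are the inner products of the columns
  of the incidence matrix, so the results on powers of the Coxeter matrix apply to it.
\<close>
lemma coxeter_numbers_of_quiver:
  assumes n: "n > 0" and unit: "unit_form n q" and rep: "represents Q n q"
  shows "coxeter_number n q \<noteq> \<infinity> \<longleftrightarrow> length (quiver_cycle_type Q) = 1"
    and "length (quiver_cycle_type Q) = 1 \<Longrightarrow> coxeter_number n q = enat (hd (quiver_cycle_type Q))"
    and "reduced_coxeter_number n q = Lcm (set (quiver_cycle_type Q))"
proof -
  have card_arcs: "card (arcs Q) = n"
    and form: "\<And>x. x \<in> carrier_vec n \<Longrightarrow> of_int (q x) = quiver_form Q x"
    using rep by (auto simp: represents_def)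
  interpret conn_quiver Q
  proof (rule conn_quiver.intro)
    show "conn_quiver_axioms Q"
      using rep n card_arcs by unfold_locales (auto simp: represents_def)
  qed (use rep in \<open>auto simp: represents_def\<close>)
  let ?I = "incidence_mat Q"
  have I: "?I \<in> carrier_mat m n" using incidence_carrier by (simp add: card_arcs)
  obtain G where G: "is_upper_gram n q G"
    using unit by (auto simp: unit_form_def integral_form_def)
  then have Gc: "G \<in> carrier_mat n n" and ut: "upper_triangular G"
    by (auto simp: is_upper_gram_def)
  have gram: "upper_gram n q = G" using G by (rule upper_gramI)
  have diag: "G $$ (i, i) = 1" if "i < n" for i
    using unit that by (simp add: unit_form_def gram)
  have off: "G $$ (i, j) = (\<Sum>x\<in>verts Q. coord x i * coord x j)" if ij: "i < j" "j < n" for i j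
  proof -
    have norm: "2 * q x = (?I *\<^sub>v x) \<bullet> (?I *\<^sub>v x)" if "x \<in> carrier_vec n" for x
    proof -
      have "of_int (2 * q x) = (of_int ((?I *\<^sub>v x) \<bullet> (?I *\<^sub>v x)) :: rat)"
        using form[OF that] by (simp add: quiver_form_def)
      then show ?thesis by (simp only: of_int_eq_iff)
    qed
    have col: "?I *\<^sub>v unit_vec n k = col ?I k" if "k < n" for k
      using I that by (intro eq_vecI) auto
    have i: "i < n" using ij by simp
    define a where "a = col ?I i"
    define b where "b = col ?I j"
    have a: "a \<in> carrier_vec m" unfolding a_def by (rule col_carrier_vec[OF i I])
    have b: "b \<in> carrier_vec m" unfolding b_def by (rule col_carrier_vec[OF ij(2) I])
    have "?I *\<^sub>v (unit_vec n i + unit_vec n j) = a + b"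
      using mult_add_distrib_mat_vec[OF I, of "unit_vec n i" "unit_vec n j"]
      by (simp add: a_def b_def col[OF i] col[OF ij(2)])
    then have "2 * q (unit_vec n i + unit_vec n j) = (a + b) \<bullet> (a + b)"
      using norm[of "unit_vec n i + unit_vec n j"] by simp
    also have "\<dots> = a \<bullet> a + a \<bullet> b + (b \<bullet> a + b \<bullet> b)"
      using a b by (simp add: add_scalar_prod_distrib[of _ m] scalar_prod_add_distrib[of _ m])
    also have "b \<bullet> a = a \<bullet> b" by (rule comm_scalar_prod[OF b a])
    finally have "G $$ (i, j) = a \<bullet> b"
      using is_upper_gram_entry[OF G ij] norm[of "unit_vec n i"] norm[of "unit_vec n j"]
      by (simp add: col[OF i] col[OF ij(2)] a_def[symmetric] b_def[symmetric])
    also have "a \<bullet> b = (\<Sum>u<m. coord (vs ! u) i * coord (vs ! u) j)"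
      using carrier_matD[OF I] i ij(2)
      by (simp add: a_def b_def scalar_prod_def lessThan_atLeast0 incidence_index card_arcs)
    also have "\<dots> = (\<Sum>x\<in>verts Q. coord x i * coord x j)" by (rule sum_over_vertices)
    finally show ?thesis by simp
  qed
  define H where "H = mat_inv G"
  note inv = inverse_upper_unitriangular[OF Gc ut diag, folded H_def]
  have cox: "coxeter_matrix n q = - (G\<^sup>T * H)" by (simp add: coxeter_matrix_def gram H_def)
  have one: "coxeter_matrix n q ^\<^sub>m k = 1\<^sub>m n \<longleftrightarrow> card orbits = 1 \<and> m dvd k" if "k \<ge> 1" for k
    unfolding cox
    using coxeter_pow_eq_one_iff[of G H k] Gc inv ut diag off that by (simp add: card_arcs)
  have nil: "nilpotent_mat (1\<^sub>m n - coxeter_matrix n q ^\<^sub>m k) \<longleftrightarrow> Lcm (card ` orbits) dvd k" for k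
    unfolding cox
    using coxeter_pow_unipotent_iff[of G H k] Gc inv ut diag off by (simp add: card_arcs)
  have m1: "m \<ge> 1" using m_pos by simp
  have finite_iff: "(\<exists>k\<ge>1. coxeter_matrix n q ^\<^sub>m k = 1\<^sub>m n) \<longleftrightarrow> card orbits = 1"
    using one m1 by (metis dvd_refl)
  show "coxeter_number n q \<noteq> \<infinity> \<longleftrightarrow> length (quiver_cycle_type Q) = 1"
    unfolding coxeter_number_def finite_iff length_quiver_cycle_type by simp
  show "coxeter_number n q = enat (hd (quiver_cycle_type Q))"
    if "length (quiver_cycle_type Q) = 1"
  proof -
    have 1: "card orbits = 1" using that by (simp only: length_quiver_cycle_type)
    then have ex: "\<exists>k\<ge>1. coxeter_matrix n q ^\<^sub>m k = 1\<^sub>m n" by (simp only: finite_iff)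
    have eq: "(\<lambda>k. k \<ge> 1 \<and> coxeter_matrix n q ^\<^sub>m k = 1\<^sub>m n) = (\<lambda>k. k \<ge> 1 \<and> m dvd k)"
      using one 1 by auto
    have "coxeter_number n q = enat m"
      by (subst coxeter_number_def, subst if_P[OF ex]) (simp only: eq Least_pos_multiple[OF m1])
    then show ?thesis by (simp only: hd_quiver_cycle_type[OF 1])
  qed
  have "Lcm (card ` orbits) \<ge> 1" using Lcm_card_orbits_pos by simp
  then show "reduced_coxeter_number n q = Lcm (set (quiver_cycle_type Q))"
    by (simp only: reduced_coxeter_number_def nil Least_pos_multiple set_quiver_cycle_type)
qed

theorem corollary6p4:
  fixes n c :: nat and q :: "int vec \<Rightarrow> int"
  assumes "c < n" and "q \<in> UQuad_A c n"
  shows "((coxeter_number n q \<noteq> \<infinity> \<longleftrightarrow> length (cycle_type n q) = 1) \<and>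
          (length (cycle_type n q) = 1 \<longrightarrow> coxeter_number n q = enat (hd (cycle_type n q)))) \<and>
         reduced_coxeter_number n q = Lcm (set (cycle_type n q))"
proof -
  have "represents (SOME Q. represents Q n q) n q"
    using exists_representing_quiver[OF assms] by (rule someI_ex)
  moreover have "unit_form n q" "n > 0" using assms by (auto simp: UQuad_A_def)
  ultimately show ?thesis
    unfolding cycle_type_def using coxeter_numbers_of_quiver by blast
qed

end
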